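(* Let $d=2$, $\mathcal{R}=\{\pm e_1,\pm e_2,e_1\pm e_2,-e_1\pm e_2\}$, $a_1,a_2,K_1,K_2>0$, and $$W_{\rm atom}(A)=\frac{K_1}{4}\sum_{\rho\in\mathcal{R},\,|\rho|=1}(|A_\rho|-a_1)^2+\frac{K_2}{4}\sum_{\rho\in\mathcal{R},\,|\rho|=\sqrt2}(|A_\rho|-a_2)^2 .$$ Set $$r^\ast=\frac{K_1a_1+\sqrt2K_2a_2}{K_1+2K_2},\qquad\alpha=\frac{a_2}{\sqrt2a_1},\qquad\kappa=\frac{K_2}{K_1},\qquad\beta=\frac{1+2\kappa}{1+2\alpha\kappa}.$$ Then $$\tilde\lambda_{\rm LH}(r^\ast\operatorname{Id})=\frac{K_1}{12}\,\beta\min\{1,2\alpha\kappa\}>0$$ for all parameter values, while $\lambda_{\rm atom}(r^\ast\operatorname{Id})>0$ if and only if $\beta<2$, which corresponds to $\alpha\ge\frac12$ or ($\alpha<\frac12$ and $\kappa<\frac{1}{2(1-2\alpha)}$).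
   Context: $A=(A_\rho)_{\rho\in\mathcal{R}}\in(\mathbb{R}^2)^{\mathcal{R}}$. For a matrix $A_0\in\mathbb{R}^{d\times d}$ put $K=D^2W_{\rm atom}((A_0\rho)_{\rho\in\mathcal{R}})$, a bilinear form on $(\mathbb{R}^d)^{\mathcal{R}}$, and $L[A,B]=K[(A\rho)_{\rho\in\mathcal{R}},(B\rho)_{\rho\in\mathcal{R}}]$ for $A,B\in\mathbb{R}^{d\times d}$. Then $$\tilde\lambda_{\rm LH}(A_0)=\inf_{\xi,\eta\in\mathbb{R}^d\setminus\{0\}}\frac{L[\xi\otimes\eta,\xi\otimes\eta]}{|\xi|^2\sum_{\rho\in\mathcal{R}}(\rho\cdot\eta)^2}.$$ Atomistic stability constant: $D_{\mathcal{R},\varepsilon}y(x)=\big(\frac{y(x+\varepsilon\rho)-y(x)}{\varepsilon}\big)_{\rho\in\mathcal{R}}$; $R_0=\max\{\max_{\rho\in\mathcal{R}}|\rho|,\sqrt d/4\}$; for an open, bounded, nonempty $\Omega\subset\mathbb{R}^d$, $\operatorname{sint}_\varepsilon\Omega=\{x\in\Omega\cap\varepsilon\mathbb{Z}^d:\operatorname{dist}(x,\partial\Omega)>\varepsilon R_0\}$ and $\mathcal{A}_\varepsilon(\Omega,0)$ is the set of $y\colon\Omega\cap\varepsilon\mathbb{Z}^d\to\mathbb{R}^d$ with $y(x)=0$ whenever $\operatorname{dist}(x,\partial\Omega)\le2\varepsilon R_0$; then $$\lambda_{\rm atom}(A_0)=\inf_{\varepsilon>0}\ \inf_{y\in\mathcal{A}_\varepsilon(\Omega,0),\,y\ne0}\frac{\sum_{x\in\operatorname{sint}_\varepsilon\Omega}K[D_{\mathcal{R},\varepsilon}y(x),D_{\mathcal{R},\varepsilon}y(x)]}{\sum_{x\in\operatorname{sint}_\varepsilon\Omega}|D_{\mathcal{R},\varepsilon}y(x)|^2},$$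 which does not depend on the choice of $\Omega$. *)

theory Defs
  imports "HOL-Analysis.Analysis"
begin

text \<open>
  Throughout, a finite interaction range is given by an injective family
  \<open>\<rho> :: 'r \<Rightarrow> real^'d\<close> over a finite index type. The space of families of vectors
  indexed by the range is then \<open>real^'d^'r\<close>, with its Euclidean norm.
\<close>

text \<open>
  Second Frechet derivative as a bilinear form; meaningful where \<open>W\<close> is twice
  differentiable (elsewhere \<open>frechet_derivative\<close> is an arbitrary value).
  \<open>W_atom\<close> below is smooth wherever no component \<open>A $ r\<close> vanishes.
\<close>

definition second_deriv ::
    "('a::real_normed_vector \<Rightarrow> real) \<Rightarrow> 'a \<Rightarrow> 'a \<Rightarrow> 'a \<Rightarrow> real" where
  "second_deriv W a u v =
     frechet_derivative (\<lambda>b. frechet_derivative W (at b) u) (at a) v"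

definition lin_family :: "('r::finite \<Rightarrow> real^'d) \<Rightarrow> real^'d^'d \<Rightarrow> real^'d^'r" where
  "lin_family \<rho> A = (\<chi> r. A *v \<rho> r)"

definition K_form ::
    "(real^'d^'r \<Rightarrow> real) \<Rightarrow> ('r::finite \<Rightarrow> real^'d) \<Rightarrow> real^'d^'d \<Rightarrow>
       real^'d^'r \<Rightarrow> real^'d^'r \<Rightarrow> real" where
  "K_form W \<rho> A0 = second_deriv W (lin_family \<rho> A0)"

definition L_form ::
    "(real^'d^'r \<Rightarrow> real) \<Rightarrow> ('r::finite \<Rightarrow> real^'d) \<Rightarrow> real^'d^'d \<Rightarrow>
       real^'d^'d \<Rightarrow> real^'d^'d \<Rightarrow> real" where
  "L_form W \<rho> A0 A B = K_form W \<rho> A0 (lin_family \<rho> A) (lin_family \<rho> B)"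

definition tensor :: "real^'d \<Rightarrow> real^'d \<Rightarrow> real^'d^'d" where
  "tensor \<xi> \<eta> = (\<chi> i j. \<xi> $ i * \<eta> $ j)"

text \<open>
  The infima are taken in the extended reals, where they always exist and the
  infimum of the empty set is \<open>\<infinity>\<close>.
\<close>

definition lambda_LH ::
    "(real^'d^'r \<Rightarrow> real) \<Rightarrow> ('r::finite \<Rightarrow> real^'d) \<Rightarrow> real^'d^'d \<Rightarrow> ereal" where
  "lambda_LH W \<rho> A0 =
     (INF (\<xi>, \<eta>) \<in> {(\<xi>, \<eta>). \<xi> \<noteq> 0 \<and> \<eta> \<noteq> 0}.
        ereal (L_form W \<rho> A0 (tensor \<xi> \<eta>) (tensor \<xi> \<eta>) /
               ((norm \<xi>)\<^sup>2 * (\<Sum>r\<in>UNIV. (\<rho> r \<bullet> \<eta>)\<^sup>2))))"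

definition lattice :: "real \<Rightarrow> (real^'d) set" where
  "lattice \<epsilon> = {\<epsilon> *\<^sub>R z | z. \<forall>i. z $ i \<in> \<int>}"

definition R0 :: "('r::finite \<Rightarrow> real^'d) \<Rightarrow> real" where
  "R0 \<rho> = max (MAX r. norm (\<rho> r)) (sqrt (real CARD('d)) / 4)"

definition discrete_grad ::
    "('r::finite \<Rightarrow> real^'d) \<Rightarrow> real \<Rightarrow> (real^'d \<Rightarrow> real^'d) \<Rightarrow> real^'d \<Rightarrow> real^'d^'r" where
  "discrete_grad \<rho> \<epsilon> y x = (\<chi> r. (1 / \<epsilon>) *\<^sub>R (y (x + \<epsilon> *\<^sub>R \<rho> r) - y x))"

definition sint ::
    "('r::finite \<Rightarrow> real^'d) \<Rightarrow> real \<Rightarrow> (real^'d) set \<Rightarrow> (real^'d) set" where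
  "sint \<rho> \<epsilon> \<Omega> = {x \<in> \<Omega> \<inter> lattice \<epsilon>. infdist x (frontier \<Omega>) > \<epsilon> * R0 \<rho>}"

text \<open>
  A function on \<open>\<Omega> \<inter> lattice \<epsilon>\<close> is represented by its extension by zero, so that the
  zero function is represented by \<open>\<lambda>_. 0\<close> only. For \<open>x \<in> sint \<rho> \<epsilon> \<Omega>\<close> and \<open>\<rho>\<close> with
  values in the integer lattice, \<open>discrete_grad \<rho> \<epsilon> y x\<close> evaluates \<open>y\<close> only at points
  of \<open>\<Omega> \<inter> lattice \<epsilon>\<close>.
\<close>

definition admissible ::
    "('r::finite \<Rightarrow> real^'d) \<Rightarrow> real \<Rightarrow> (real^'d) set \<Rightarrow> (real^'d \<Rightarrow> real^'d) set" where
  "admissible \<rho> \<epsilon> \<Omega> =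
     {y. (\<forall>x. x \<notin> \<Omega> \<inter> lattice \<epsilon> \<longrightarrow> y x = 0) \<and>
         (\<forall>x\<in>\<Omega> \<inter> lattice \<epsilon>. infdist x (frontier \<Omega>) \<le> 2 * \<epsilon> * R0 \<rho> \<longrightarrow> y x = 0)}"

definition lambda_atom ::
    "(real^'d^'r \<Rightarrow> real) \<Rightarrow> ('r::finite \<Rightarrow> real^'d) \<Rightarrow> (real^'d) set \<Rightarrow> real^'d^'d \<Rightarrow> ereal"
  where
  "lambda_atom W \<rho> \<Omega> A0 =
     (INF \<epsilon> \<in> {0<..}. INF y \<in> admissible \<rho> \<epsilon> \<Omega> - {\<lambda>_. 0}.
        ereal ((\<Sum>x\<in>sint \<rho> \<epsilon> \<Omega>.
                  K_form W \<rho> A0 (discrete_grad \<rho> \<epsilon> y x) (discrete_grad \<rho> \<epsilon> y x)) /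
               (\<Sum>x\<in>sint \<rho> \<epsilon> \<Omega>. (norm (discrete_grad \<rho> \<epsilon> y x))\<^sup>2)))"

abbreviation e1 :: "real^2" where "e1 \<equiv> axis 1 1"
abbreviation e2 :: "real^2" where "e2 \<equiv> axis 2 1"

typedef range8 =
  "{e1, - e1, e2, - e2, e1 + e2, e1 - e2, - e1 + e2, - e1 - e2}"
  morphisms vec_of Abs_range8
  by blast

instance range8 :: finite
proof
  have "(UNIV :: range8 set) =
      Abs_range8 ` {e1, - e1, e2, - e2, e1 + e2, e1 - e2, - e1 + e2, - e1 - e2}"
    by (rule type_definition.univ [OF type_definition_range8])
  then show "finite (UNIV :: range8 set)"
    by (metis finite.emptyI finite.insertI finite_imageI)
qed

definition W_atom :: "real \<Rightarrow> real \<Rightarrow> real \<Rightarrow> real \<Rightarrow> real^2^range8 \<Rightarrow> real" where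
  "W_atom a1 a2 K1 K2 A =
     K1 / 4 * (\<Sum>r | norm (vec_of r) = 1. (norm (A $ r) - a1)\<^sup>2) +
     K2 / 4 * (\<Sum>r | norm (vec_of r) = sqrt 2. (norm (A $ r) - a2)\<^sup>2)"

end

theory Submission
  imports Defs
begin

text \<open>
  At \<open>r\<^sup>* Id\<close> the form \<open>K\<close> splits over the eight bonds, with coefficients \<open>1 - \<beta>\<close> and
  \<open>1 - \<alpha>\<beta>\<close> on the squared bond differences; the choice of \<open>r\<^sup>*\<close> is exactly
  the balance \<open>K1 (1 - \<beta>) + 2 K2 (1 - \<alpha>\<beta>) = 0\<close>. On rank-one families these terms
  cancel, which leaves an elementary minimisation for \<open>\<lambda>\<^sub>L\<^sub>H\<close>. On lattice functions
  they cancel up to a multiple \<open>(1 - \<beta>) / 2\<close> of \<open>K1 \<Sum>|D\<^sub>1 D\<^sub>2 y|\<^sup>2\<close>, by the parallelogram identity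
  on lattice squares. For \<open>1 < \<beta> < 2\<close> this defect is absorbed by the longitudinal energy
  \<open>K1 \<beta> \<Sum>((D\<^sub>1 y\<^sub>1)\<^sup>2 + (D\<^sub>2 y\<^sub>2)\<^sup>2)\<close>, since \<open>D\<^sub>1\<close> and \<open>D\<^sub>2\<close> have norm at most 2, and a discrete
  Korn inequality gives coercivity. For \<open>\<beta> \<ge> 2\<close> the checkerboard \<open>(-1)\<^bsup>i + j\<^esup> e\<^sub>1\<close> has nonpositive
  energy density \<open>4 K1 (2 - \<beta>)\<close>; cut off to an \<open>n \<times> n\<close> box it costs only \<open>O(n)\<close> against a
  denominator of order \<open>n\<^sup>2\<close>.
\<close>

section \<open>Finitely supported functions\<close>

definition fin_supp :: "('a \<Rightarrow> 'b::zero) \<Rightarrow> bool" where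
  "fin_supp f \<longleftrightarrow> finite {x. f x \<noteq> 0}"

lemma fin_supp_subset:
  assumes "fin_supp f" "\<And>x. f x = 0 \<Longrightarrow> g x = 0"
  shows "fin_supp g"
  using assms unfolding fin_supp_def by (elim finite_subset[rotated]) auto

lemma fin_supp_add:
  fixes f g :: "'a \<Rightarrow> 'b::monoid_add"
  assumes "fin_supp f" "fin_supp g"
  shows "fin_supp (\<lambda>x. f x + g x)"
  using assms unfolding fin_supp_def
  by (rule finite_subset[OF _ finite_UnI, rotated]) auto

lemma fin_supp_diff:
  fixes f g :: "'a \<Rightarrow> 'b::group_add"
  assumes "fin_supp f" "fin_supp g"
  shows "fin_supp (\<lambda>x. f x - g x)"
  using assms unfolding fin_supp_def
  by (rule finite_subset[OF _ finite_UnI, rotated]) auto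

lemma fin_supp_mult:
  fixes f g :: "'a \<Rightarrow> 'b::mult_zero"
  shows "fin_supp f \<Longrightarrow> fin_supp (\<lambda>x. f x * g x)"
  by (erule fin_supp_subset) simp

lemma fin_supp_cmult:
  fixes f :: "'a \<Rightarrow> 'b::mult_zero"
  shows "fin_supp f \<Longrightarrow> fin_supp (\<lambda>x. c * f x)"
  by (erule fin_supp_subset) simp

lemma fin_supp_power2:
  fixes f :: "'a \<Rightarrow> real"
  shows "fin_supp f \<Longrightarrow> fin_supp (\<lambda>x. (f x)\<^sup>2)"
  by (erule fin_supp_subset) simp

lemma fin_supp_shift:
  fixes f :: "'a::group_add \<Rightarrow> 'b::zero"
  assumes "fin_supp f"
  shows "fin_supp (\<lambda>x. f (x + h))"
proof -
  have "{x. f (x + h) \<noteq> 0} = (\<lambda>x. x - h) ` {x. f x \<noteq> 0}"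
    by (auto simp: image_iff) (metis add_diff_cancel)
  then show ?thesis using assms by (simp add: fin_supp_def)
qed

lemmas fin_supp_intros =
  fin_supp_add fin_supp_diff fin_supp_mult fin_supp_cmult fin_supp_power2

text \<open>Summing with \<open>infsum\<close> over the whole group makes translation invariance
  (\<open>total_shift\<close>) a plain bijective reindexing; finite support enters where sums are
  split or compared.\<close>

abbreviation total :: "('a \<Rightarrow> real) \<Rightarrow> real" where
  "total f \<equiv> infsum f UNIV"

lemma fin_supp_summable:
  fixes f :: "'a \<Rightarrow> real"
  assumes "fin_supp f"
  shows "f summable_on UNIV"
proof -
  have "f summable_on {x. f x \<noteq> 0}"
    using assms by (simp add: fin_supp_def)
  then show ?thesis
    by (subst summable_on_cong_neutral[where T="{x. f x \<noteq> 0}" and g=f]) auto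
qed

lemma total_eq_sum:
  assumes "finite T" "\<And>x. x \<notin> T \<Longrightarrow> f x = 0"
  shows "total f = sum f T"
  using infsum_cong_neutral[of UNIV T f f] assms by auto

lemma total_add: "fin_supp f \<Longrightarrow> fin_supp g \<Longrightarrow> total (\<lambda>x. f x + g x) = total f + total g"
  by (intro infsum_add fin_supp_summable)

lemma total_cmult: "total (\<lambda>x. c * f x) = c * total f"
  by (simp add: infsum_cmult_right')

lemma total_diff: "fin_supp f \<Longrightarrow> fin_supp g \<Longrightarrow> total (\<lambda>x. f x - g x) = total f - total g"
  using total_add[of f "\<lambda>x. - 1 * g x"] total_cmult[of "- 1" g] fin_supp_cmult[of g "- 1"] by simp

lemma total_mono:
  "fin_supp f \<Longrightarrow> fin_supp g \<Longrightarrow> (\<And>x. f x \<le> g x) \<Longrightarrow> total f \<le> total g"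
  by (intro infsum_mono fin_supp_summable)

lemma total_shift:
  fixes f :: "'a::group_add \<Rightarrow> real"
  shows "total (\<lambda>x. f (x + h)) = total f"
  using infsum_reindex_bij_betw[of "\<lambda>x. x + h" UNIV UNIV f] by (simp add: bij_plus_right)

lemma total_shift_cong:
  fixes f g :: "'a::group_add \<Rightarrow> real"
  assumes "\<And>x. f x = g (x + h)"
  shows "total f = total g"
  using total_shift[of g h] unfolding assms .

section \<open>Difference energies and a discrete Korn inequality\<close>

definition diff_energy :: "'a::ab_group_add \<Rightarrow> ('a \<Rightarrow> real) \<Rightarrow> real" where
  "diff_energy h f = total (\<lambda>x. (f (x + h) - f x)\<^sup>2)"

text \<open>The squared l2 norm of the second difference D_h D_k f, that is, of the alternating sum
  over the corners of the parallelogram spanned by \<open>h\<close> and \<open>k\<close> at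
  \<open>x\<close>.\<close>

definition mixed_energy :: "'a::ab_group_add \<Rightarrow> 'a \<Rightarrow> ('a \<Rightarrow> real) \<Rightarrow> real" where
  "mixed_energy h k f = total (\<lambda>x. (f (x + h + k) - f (x + h) - (f (x + k) - f x))\<^sup>2)"

lemma diff_energy_nonneg: "0 \<le> diff_energy h f"
  unfolding diff_energy_def by (rule infsum_nonneg) simp

lemma mixed_energy_nonneg: "0 \<le> mixed_energy h k f"
  unfolding mixed_energy_def by (rule infsum_nonneg) simp

lemma diff_energy_minus: "diff_energy (- h) f = diff_energy h f"
  unfolding diff_energy_def
  by (rule sym, rule total_shift_cong[where h = h]) (simp add: power2_commute)

text \<open>Shifting the base point by \<open>k\<close> places the antidiagonal in the parallelogram
  with corner \<open>x\<close>, alongside the other bonds.\<close>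

lemma diff_energy_diff:
  "diff_energy (h - k) f = total (\<lambda>x. (f (x + h) - f (x + k))\<^sup>2)"
  unfolding diff_energy_def
  by (rule sym, rule total_shift_cong[where h = k]) (simp add: add.assoc)

lemma mixed_energy_commute: "mixed_energy h k f = mixed_energy k h f"
  unfolding mixed_energy_def by (simp add: algebra_simps)

text \<open>Pointwise this is Euler's quadrilateral identity: the squared sides sum to the squared
  diagonals plus the squared alternating sum of the corners. After summation each side direction
  occurs twice, by translation invariance.\<close>

lemma diff_energy_diagonals:
  assumes "fin_supp f"
  shows "diff_energy (h + k) f + diff_energy (h - k) f =
    2 * diff_energy h f + 2 * diff_energy k f - mixed_energy h k f"
proof -
  note fs = assms fin_supp_shift[OF assms] fin_supp_shift[OF fin_supp_shift[OF assms]] fin_supp_intros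
  have h': "total (\<lambda>x. (f (x + k + h) - f (x + k))\<^sup>2) = diff_energy h f"
    unfolding diff_energy_def by (rule total_shift_cong[where h = k]) simp
  have k': "total (\<lambda>x. (f (x + h + k) - f (x + h))\<^sup>2) = diff_energy k f"
    unfolding diff_energy_def by (rule total_shift_cong[where h = h]) simp
  have "diff_energy (h + k) f + diff_energy (h - k) f + mixed_energy h k f
      = total (\<lambda>x. (f (x + h + k) - f x)\<^sup>2 + (f (x + h) - f (x + k))\<^sup>2 +
          (f (x + h + k) - f (x + h) - (f (x + k) - f x))\<^sup>2)"
    unfolding diff_energy_diff mixed_energy_def unfolding diff_energy_def add.assoc[symmetric]
    by (simp add: total_add fs)
  also have "\<dots> = total (\<lambda>x. (f (x + h) - f x)\<^sup>2 + (f (x + k + h) - f (x + k))\<^sup>2 +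
          (f (x + k) - f x)\<^sup>2 + (f (x + h + k) - f (x + h))\<^sup>2)"
    by (rule infsum_cong) (simp add: power2_eq_square algebra_simps)
  also have "\<dots> = 2 * diff_energy h f + 2 * diff_energy k f"
    using h' k' by (simp add: total_add fs flip: diff_energy_def)
  finally show ?thesis by simp
qed

text \<open>The operator D_h has norm at most 2; it is applied here to D_k f.\<close>

lemma mixed_energy_le:
  assumes "fin_supp f"
  shows "mixed_energy h k f \<le> 4 * diff_energy k f"
proof -
  note fs = assms fin_supp_shift[OF assms] fin_supp_shift[OF fin_supp_shift[OF assms]] fin_supp_intros
  have k': "total (\<lambda>x. (f (x + h + k) - f (x + h))\<^sup>2) = diff_energy k f"
    unfolding diff_energy_def by (rule total_shift_cong[where h = h]) simp
  have "mixed_energy h k f \<le>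
      total (\<lambda>x. 2 * (f (x + h + k) - f (x + h))\<^sup>2 + 2 * (f (x + k) - f x)\<^sup>2)"
    unfolding mixed_energy_def
  proof (rule total_mono)
    show "(f (x + h + k) - f (x + h) - (f (x + k) - f x))\<^sup>2
        \<le> 2 * (f (x + h + k) - f (x + h))\<^sup>2 + 2 * (f (x + k) - f x)\<^sup>2" for x
      using zero_le_power2[of "f (x + h + k) - f (x + h) + (f (x + k) - f x)"]
      by (simp add: power2_eq_square algebra_simps)
  qed (intro fs)+
  also have "\<dots> = 4 * diff_energy k f"
    using k' by (simp add: total_add total_cmult fs flip: diff_energy_def)
  finally show ?thesis .
qed

text \<open>Summation by parts twice: the adjoint of D_h is D_{-h}, and difference operators
  commute.\<close>

lemma total_cross_diff:
  fixes f g :: "'a::ab_group_add \<Rightarrow> real"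
  assumes "fin_supp f" "fin_supp g"
  shows "total (\<lambda>x. (f (x + k) - f x) * (g (x + h) - g x)) =
    total (\<lambda>x. (f (x + - h) - f x) * (g (x + - k) - g x))"
proof -
  note fs = assms fin_supp_shift[OF assms(1)] fin_supp_shift[OF assms(2)] fin_supp_intros
  have expand: "total (\<lambda>x. (f (x + a) - f x) * (g (x + b) - g x)) =
      total (\<lambda>x. f (x + a) * g (x + b)) - total (\<lambda>x. f (x + a) * g x)
      - total (\<lambda>x. f x * g (x + b)) + total (\<lambda>x. f x * g x)" for a b
    by (simp add: algebra_simps total_add total_diff fs)
  have "total (\<lambda>x. f (x + k) * g (x + h)) = total (\<lambda>x. f (x + - h) * g (x + - k))"
    by (rule total_shift_cong[where h = "h + k"]) (simp add: algebra_simps)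
  moreover have "total (\<lambda>x. f (x + k) * g x) = total (\<lambda>x. f x * g (x + - k))"
    by (rule total_shift_cong[where h = k]) simp
  moreover have "total (\<lambda>x. f x * g (x + h)) = total (\<lambda>x. f (x + - h) * g x)"
    by (rule total_shift_cong[where h = h]) simp
  ultimately show ?thesis unfolding expand by simp
qed

text \<open>The shear D_k f + D_h g equals D_h f + D_k g minus the difference of f - g between
  \<open>x + h\<close> and \<open>x + k\<close>. Bounding its square still leaves the cross term of
  D_k f and D_h g, which summation by parts turns into one between longitudinal differences. The 4
  is 3 from Cauchy-Schwarz plus 1 from that cross term.\<close>

lemma discrete_Korn:
  fixes f g :: "'a::ab_group_add \<Rightarrow> real"
  assumes "fin_supp f" "fin_supp g"
  shows "diff_energy k f + diff_energy h g \<le>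
    4 * (diff_energy h f + diff_energy k g) + 3 * diff_energy (h - k) (\<lambda>x. f x - g x)"
proof -
  note fs = assms fin_supp_shift[OF assms(1)] fin_supp_shift[OF assms(2)] fin_supp_intros
  let ?X = "total (\<lambda>x. (f (x + k) - f x) * (g (x + h) - g x))"
  \<comment> \<open>Only the lower bound on the cross term is needed; it comes from expanding this
    nonnegative square of backward differences and rewriting its cross term as
    \<open>?X\<close>.\<close>
  have "0 \<le> total (\<lambda>x. ((f (x + - h) - f x) + (g (x + - k) - g x))\<^sup>2)"
    by (rule infsum_nonneg) simp
  also have "\<dots> = total (\<lambda>x. (f (x + - h) - f x)\<^sup>2 +
      2 * ((f (x + - h) - f x) * (g (x + - k) - g x)) + (g (x + - k) - g x)\<^sup>2)"
    by (simp add: power2_eq_square algebra_simps)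
  also have "\<dots> = diff_energy (- h) f + 2 * ?X + diff_energy (- k) g"
    unfolding total_cross_diff[OF assms, of k h] diff_energy_def
    by (simp add: total_add total_cmult fs del: add_uminus_conv_diff)
  finally have X: "- 2 * ?X \<le> diff_energy h f + diff_energy k g"
    by (simp add: diff_energy_minus)
  have "diff_energy k f + 2 * ?X + diff_energy h g =
      total (\<lambda>x. (f (x + k) - f x)\<^sup>2 + 2 * ((f (x + k) - f x) * (g (x + h) - g x))
        + (g (x + h) - g x)\<^sup>2)"
    unfolding diff_energy_def by (simp add: total_add total_cmult fs)
  also have "\<dots> \<le> total (\<lambda>x. 3 * (f (x + h) - f x)\<^sup>2 + 3 * (g (x + k) - g x)\<^sup>2
        + 3 * ((f (x + h) - g (x + h)) - (f (x + k) - g (x + k)))\<^sup>2)"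
  proof (rule total_mono)
    fix x
    \<comment> \<open>Three-term Cauchy-Schwarz for \<open>s + t - w\<close>, with \<open>p\<close>
      and \<open>q\<close> the transverse and \<open>s\<close> and \<open>t\<close> the longitudinal
      differences, and \<open>w\<close> the antidiagonal one.\<close>
    have ineq: "p\<^sup>2 + 2 * (p * q) + q\<^sup>2 \<le> 3 * s\<^sup>2 + 3 * t\<^sup>2 + 3 * w\<^sup>2"
      if "p + q = s + t - w" for p q s t w :: real
    proof -
      have "p\<^sup>2 + 2 * (p * q) + q\<^sup>2 = (s + t - w)\<^sup>2"
        unfolding that[symmetric] by (simp add: power2_eq_square algebra_simps)
      moreover have "3 * s\<^sup>2 + 3 * t\<^sup>2 + 3 * w\<^sup>2 - (s + t - w)\<^sup>2 = (s - t)\<^sup>2 + (s + w)\<^sup>2 + (t + w)\<^sup>2"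
        by (simp add: power2_eq_square algebra_simps)
      ultimately show ?thesis
        using zero_le_power2[of "s - t"] zero_le_power2[of "s + w"] zero_le_power2[of "t + w"]
        by linarith
    qed
    show "(f (x + k) - f x)\<^sup>2 + 2 * ((f (x + k) - f x) * (g (x + h) - g x)) + (g (x + h) - g x)\<^sup>2
      \<le> 3 * (f (x + h) - f x)\<^sup>2 + 3 * (g (x + k) - g x)\<^sup>2
        + 3 * ((f (x + h) - g (x + h)) - (f (x + k) - g (x + k)))\<^sup>2"
      by (rule ineq) simp
  qed (intro fs)+
  also have "\<dots> = 3 * diff_energy h f + 3 * diff_energy k g
      + 3 * diff_energy (h - k) (\<lambda>x. f x - g x)"
    unfolding diff_energy_diff unfolding diff_energy_def
    by (simp add: total_add total_cmult fs)
  finally show ?thesis using X by simp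
qed

section \<open>The Hessian of the pair potential\<close>

lemma has_derivative_pair_potential:
  fixes b :: "'a::real_inner"
  assumes "b \<noteq> 0"
  shows "((\<lambda>b. (norm b - l)\<^sup>2) has_derivative (\<lambda>u. 2 * (norm b - l) * (sgn b \<bullet> u))) (at b)"
  by (rule derivative_eq_intros has_derivative_norm assms refl)+ (auto simp: fun_eq_iff inner_commute algebra_simps)

text \<open>The Hessian of (|b| - l)^2 is 2 (1 - l/|b|) Id + (2 l/|b|^3) b (x) b. Away from 0 the
  force is rewritten as 2 b.u - 2 l (b.u)/|b|, so that only the inverse norm has to be
  differentiated and not \<open>sgn\<close>.\<close>

lemma has_derivative_pair_force:
  fixes b u :: "'a::real_inner"
  assumes "b \<noteq> 0"
  shows "((\<lambda>b. 2 * (norm b - l) * (sgn b \<bullet> u)) has_derivative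
    (\<lambda>v. 2 * (1 - l / norm b) * (u \<bullet> v) + 2 * l / norm b ^ 3 * ((b \<bullet> u) * (b \<bullet> v)))) (at b)"
proof (rule has_derivative_transform_within_open[where s = "- {0}"])
  have "((\<lambda>b. 2 * (b \<bullet> u) - 2 * l * ((b \<bullet> u) * inverse (norm b))) has_derivative
      (\<lambda>v. 2 * (v \<bullet> u) - 2 * l * ((b \<bullet> u) * - (inverse (norm b) * (sgn b \<bullet> v) * inverse (norm b))
        + (v \<bullet> u) * inverse (norm b)))) (at b)"
    by (rule derivative_eq_intros has_derivative_norm has_derivative_inverse assms refl | simp add: assms inner_commute)+
  moreover have "(\<lambda>v. 2 * (v \<bullet> u) - 2 * l * ((b \<bullet> u) * - (inverse (norm b) * (sgn b \<bullet> v) * inverse (norm b))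
        + (v \<bullet> u) * inverse (norm b))) =
      (\<lambda>v. 2 * (1 - l / norm b) * (u \<bullet> v) + 2 * l / norm b ^ 3 * ((b \<bullet> u) * (b \<bullet> v)))"
    using assms
    by (simp add: fun_eq_iff sgn_div_norm inner_commute field_simps power3_eq_cube)
  ultimately show "((\<lambda>b. 2 * (b \<bullet> u) - 2 * l * ((b \<bullet> u) * inverse (norm b))) has_derivative
    (\<lambda>v. 2 * (1 - l / norm b) * (u \<bullet> v) + 2 * l / norm b ^ 3 * ((b \<bullet> u) * (b \<bullet> v)))) (at b)"
    by simp
  show "2 * (x \<bullet> u) - 2 * l * ((x \<bullet> u) * inverse (norm x)) = 2 * (norm x - l) * (sgn x \<bullet> u)"
    if "x \<in> - {0}" for x :: 'a
    using that by (simp add: sgn_div_norm field_simps)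
qed (use assms in auto)

lemma second_deriv_pair_potentials:
  fixes a u v :: "'a::euclidean_space ^ 'r::finite"
  assumes "\<And>r. a $ r \<noteq> 0"
  shows "second_deriv (\<lambda>A. \<Sum>r\<in>UNIV. w r * (norm (A $ r) - l r)\<^sup>2) a u v =
    (\<Sum>r\<in>UNIV. w r * (2 * (1 - l r / norm (a $ r)) * (u $ r \<bullet> v $ r) +
       2 * l r / norm (a $ r) ^ 3 * ((a $ r \<bullet> u $ r) * (a $ r \<bullet> v $ r))))"
    (is "second_deriv ?W a u v = _")
proof -
  \<comment> \<open>\<open>second_deriv\<close> differentiates the first derivative as a function of
    its base point, so that derivative must be known on an open neighbourhood of \<open>a\<close>
    and not only at \<open>a\<close>.\<close>
  let ?S = "{b::'a^'r. \<forall>r. b $ r \<noteq> 0}"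
  have "open ?S"
    unfolding Collect_all_eq by (intro open_INT ballI open_Collect_neq continuous_intros) auto
  have nth: "((\<lambda>b. b $ r) has_derivative (\<lambda>v. v $ r)) (at (b::'a^'r))" for r b
    by (rule bounded_linear_imp_has_derivative) (rule bounded_linear_vec_nth)
  have first: "(\<Sum>r\<in>UNIV. w r * (2 * (norm (b $ r) - l r) * (sgn (b $ r) \<bullet> u $ r)))
      = frechet_derivative ?W (at b) u" if "b \<in> ?S" for b
  proof -
    have "(?W has_derivative
        (\<lambda>u. \<Sum>r\<in>UNIV. w r * (2 * (norm (b $ r) - l r) * (sgn (b $ r) \<bullet> u $ r)))) (at b)"
      using that
      by (intro has_derivative_sum has_derivative_mult_right
          has_derivative_compose[OF nth has_derivative_pair_potential]) auto
    from frechet_derivative_at[OF this] show ?thesis by metis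
  qed
  have "((\<lambda>b. \<Sum>r\<in>UNIV. w r * (2 * (norm (b $ r) - l r) * (sgn (b $ r) \<bullet> u $ r)))
      has_derivative (\<lambda>v. \<Sum>r\<in>UNIV. w r * (2 * (1 - l r / norm (a $ r)) * (u $ r \<bullet> v $ r) +
       2 * l r / norm (a $ r) ^ 3 * ((a $ r \<bullet> u $ r) * (a $ r \<bullet> v $ r))))) (at a)"
    using assms
    by (intro has_derivative_sum has_derivative_mult_right
          has_derivative_compose[OF nth has_derivative_pair_force]) auto
  then have "((\<lambda>b. frechet_derivative ?W (at b) u)
      has_derivative (\<lambda>v. \<Sum>r\<in>UNIV. w r * (2 * (1 - l r / norm (a $ r)) * (u $ r \<bullet> v $ r) +
       2 * l r / norm (a $ r) ^ 3 * ((a $ r \<bullet> u $ r) * (a $ r \<bullet> v $ r))))) (at a)"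
    by (rule has_derivative_transform_within_open[OF _ \<open>open ?S\<close>]) (use assms first in auto)
  then show ?thesis
    unfolding second_deriv_def by (rule fun_cong[OF frechet_derivative_at, symmetric])
qed

section \<open>Coordinates in the plane and the eight bonds\<close>

lemma inner_real2: "(x::real^2) \<bullet> y = x $ 1 * y $ 1 + x $ 2 * y $ 2"
  by (simp add: inner_vec_def sum_2)

lemma norm_real2_square: "(norm (x::real^2))\<^sup>2 = (x $ 1)\<^sup>2 + (x $ 2)\<^sup>2"
  unfolding power2_norm_eq_inner inner_real2 by (simp add: power2_eq_square)

lemma norm_real2: "norm (x::real^2) = sqrt ((x $ 1)\<^sup>2 + (x $ 2)\<^sup>2)"
  by (simp flip: norm_real2_square)

lemma axis_real2 [simp]:
  "e1 $ 1 = (1::real)" "e1 $ 2 = (0::real)" "e2 $ 1 = (0::real)" "e2 $ 2 = (1::real)"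
  by (simp_all add: axis_def)

abbreviation short_bonds :: "(real^2) set" where
  "short_bonds \<equiv> {e1, - e1, e2, - e2}"

abbreviation long_bonds :: "(real^2) set" where
  "long_bonds \<equiv> {e1 + e2, e1 - e2, - e1 + e2, - e1 - e2}"

lemma sum_short_bonds: "sum G short_bonds = G e1 + G (- e1) + G e2 + G (- e2)"
  by (simp add: vec_eq_iff forall_2 add.assoc)

lemma sum_long_bonds:
  "sum G long_bonds = G (e1 + e2) + G (e1 - e2) + G (- e1 + e2) + G (- e1 - e2)"
  by (simp add: vec_eq_iff forall_2 add.assoc)

lemma norm_short_bonds: "\<rho> \<in> short_bonds \<Longrightarrow> norm \<rho> = 1"
  by (auto simp: norm_real2)

lemma norm_long_bonds: "\<rho> \<in> long_bonds \<Longrightarrow> norm \<rho> = sqrt 2"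
  by (auto simp: norm_real2)

lemma bonds_disjoint: "short_bonds \<inter> long_bonds = {}"
proof (rule equals0I)
  fix \<rho> assume "\<rho> \<in> short_bonds \<inter> long_bonds"
  then have "sqrt 2 = 1"
    using norm_short_bonds[of \<rho>] norm_long_bonds[of \<rho>] by (metis IntE)
  then show False by simp
qed

lemma finite_bonds: "finite short_bonds" "finite long_bonds"
  by simp_all

lemma bij_betw_vec_of: "bij_betw vec_of UNIV (short_bonds \<union> long_bonds)"
proof -
  have "range vec_of = short_bonds \<union> long_bonds"
    unfolding type_definition.Rep_range[OF type_definition_range8] by (simp only: insert_is_Un[symmetric] Un_insert_left Un_empty_left)
  then show ?thesis by (simp only: bij_betw_def inj_on_def vec_of_inject) simp
qed

lemma sum_vec_of: "(\<Sum>r\<in>UNIV. G (vec_of r)) = sum G short_bonds + sum G long_bonds"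
proof -
  have "sum G (short_bonds \<union> long_bonds) = sum G short_bonds + sum G long_bonds"
    by (intro sum.union_disjoint finite_bonds bonds_disjoint)
  with sum.reindex_bij_betw[OF bij_betw_vec_of, of G] show ?thesis
    by (rule trans)
qed

lemma vec_of_cases: "vec_of r \<in> short_bonds \<or> vec_of r \<in> long_bonds"
  using bij_betwE[OF bij_betw_vec_of] by blast

text \<open>Used with \<open>b = a1 / r\<close> and \<open>c = a2 / (sqrt 2 * r)\<close>, i.e. \<open>b = \<beta>\<close> and \<open>c = \<alpha>\<beta>\<close> at \<open>r = r\<^sup>*\<close>.\<close>

definition cell_energy ::
    "real \<Rightarrow> real \<Rightarrow> real \<Rightarrow> real \<Rightarrow> (real^2 \<Rightarrow> real^2) \<Rightarrow> real" where
  "cell_energy K1 K2 b c g =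
     K1 / 2 * (\<Sum>\<rho>\<in>short_bonds. (1 - b) * (norm (g \<rho>))\<^sup>2 + b * (\<rho> \<bullet> g \<rho>)\<^sup>2) +
     K2 / 2 * (\<Sum>\<rho>\<in>long_bonds. (1 - c) * (norm (g \<rho>))\<^sup>2 + c / 2 * (\<rho> \<bullet> g \<rho>)\<^sup>2)"

text \<open>At \<open>r *\<^sub>R mat 1\<close> the bond lengths are r and sqrt 2 * r, which turns
  l/|a| into \<open>a1 / r\<close> and \<open>a2 / (sqrt 2 * r)\<close>. The unnormalised projection
  onto a long bond, of squared length 2, accounts for the factor \<open>c / 2\<close> in
  \<open>cell_energy\<close>. Letting \<open>g\<close> depend on the bond vector removes the index
  type from all later computations.\<close>

lemma K_form_W_atom:
  assumes "r > 0"
  shows "K_form (W_atom a1 a2 K1 K2) vec_of (r *\<^sub>R mat 1) (\<chi> s. g (vec_of s)) (\<chi> s. g (vec_of s))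
    = cell_energy K1 K2 (a1 / r) (a2 / (sqrt 2 * r)) g"
proof -
  \<comment> \<open>Weights and rest lengths read off from the bond length merge the two sums of
    \<open>W_atom\<close> into a single one over all bonds.\<close>
  define w where "w \<rho> = (if norm \<rho> = 1 then K1 / 4 else K2 / 4)" for \<rho> :: "real^2"
  define l where "l \<rho> = (if norm \<rho> = 1 then a1 else a2)" for \<rho> :: "real^2"
  define G where "G \<rho> = w \<rho> * (2 * (1 - l \<rho> / norm (r *\<^sub>R \<rho>)) * (g \<rho> \<bullet> g \<rho>) +
      2 * l \<rho> / norm (r *\<^sub>R \<rho>) ^ 3 * ((r *\<^sub>R \<rho> \<bullet> g \<rho>) * (r *\<^sub>R \<rho> \<bullet> g \<rho>)))" for \<rho>
  have W: "W_atom a1 a2 K1 K2 =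
      (\<lambda>A. \<Sum>s\<in>UNIV. w (vec_of s) * (norm (A $ s) - l (vec_of s))\<^sup>2)"
  proof
    fix A :: "real^2^range8"
    let ?S = "{s. norm (vec_of s) = 1}" and ?L = "{s. norm (vec_of s) = sqrt 2}"
    have L: "?L = - ?S"
      using vec_of_cases norm_short_bonds norm_long_bonds by fastforce
    have "(\<Sum>s\<in>UNIV. w (vec_of s) * (norm (A $ s) - l (vec_of s))\<^sup>2)
        = (\<Sum>s\<in>?S. w (vec_of s) * (norm (A $ s) - l (vec_of s))\<^sup>2)
        + (\<Sum>s\<in>?L. w (vec_of s) * (norm (A $ s) - l (vec_of s))\<^sup>2)"
      unfolding L by (subst sum.union_disjoint[symmetric]) auto
    also have "\<dots> = W_atom a1 a2 K1 K2 A"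
      unfolding W_atom_def sum_distrib_left
      by (intro arg_cong2[where f = "(+)"] sum.cong) (auto simp: w_def l_def)
    finally show "W_atom a1 a2 K1 K2 A =
      (\<Sum>s\<in>UNIV. w (vec_of s) * (norm (A $ s) - l (vec_of s))\<^sup>2)" by simp
  qed
  have lin: "lin_family vec_of (r *\<^sub>R mat 1) $ s = r *\<^sub>R vec_of s" for s
    by (simp add: lin_family_def scaleR_matrix_vector_assoc[symmetric])
  have nz: "lin_family vec_of (r *\<^sub>R mat 1) $ s \<noteq> 0" for s
    using assms vec_of_cases[of s] norm_short_bonds[of "vec_of s"] norm_long_bonds[of "vec_of s"]
    unfolding lin by auto
  have short: "G \<rho> = K1 / 2 * ((1 - a1 / r) * (norm (g \<rho>))\<^sup>2 + a1 / r * (\<rho> \<bullet> g \<rho>)\<^sup>2)"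
    if "\<rho> \<in> short_bonds" for \<rho>
    using norm_short_bonds[OF that] assms
    by (simp add: G_def w_def l_def dot_square_norm field_simps power3_eq_cube power2_eq_square)
  have long: "G \<rho> = K2 / 2 * ((1 - a2 / (sqrt 2 * r)) * (norm (g \<rho>))\<^sup>2
      + a2 / (sqrt 2 * r) / 2 * (\<rho> \<bullet> g \<rho>)\<^sup>2)"
    if "\<rho> \<in> long_bonds" for \<rho>
    using norm_long_bonds[OF that] assms
    by (simp add: G_def w_def l_def dot_square_norm field_simps power3_eq_cube power2_eq_square)
  have "K_form (W_atom a1 a2 K1 K2) vec_of (r *\<^sub>R mat 1)
      (\<chi> s. g (vec_of s)) (\<chi> s. g (vec_of s)) = (\<Sum>s\<in>UNIV. G (vec_of s))"
    unfolding K_form_def W second_deriv_pair_potentials[OF nz] lin by (simp add: G_def)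
  also have "\<dots> = sum G short_bonds + sum G long_bonds"
    by (rule sum_vec_of)
  also have "\<dots> = cell_energy K1 K2 (a1 / r) (a2 / (sqrt 2 * r)) g"
    unfolding cell_energy_def sum_distrib_left
    by (intro arg_cong2[where f = "(+)"] sum.cong refl short long)
  finally show ?thesis .
qed

section \<open>The Legendre--Hadamard constant\<close>

lemma lin_family_tensor:
  "lin_family \<rho> (tensor \<xi> \<eta>) = (\<chi> r. (\<eta> \<bullet> \<rho> r) *\<^sub>R \<xi>)"
  by (simp add: lin_family_def tensor_def vec_eq_iff matrix_vector_mult_def inner_vec_def
      sum_distrib_left mult_ac)

text \<open>Short bonds contribute 2 and long bonds 4. This 6, together with the 1/2 in
  \<open>rank_one_lower_bound\<close>, produces the 12 in the final constant.\<close>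

lemma sum_vec_of_inner_square: "(\<Sum>s\<in>UNIV. (vec_of s \<bullet> \<eta>)\<^sup>2) = 6 * (norm \<eta>)\<^sup>2"
  unfolding sum_vec_of[of "\<lambda>\<rho>. (\<rho> \<bullet> \<eta>)\<^sup>2"] sum_short_bonds sum_long_bonds norm_real2_square
  by (simp add: inner_real2 power2_eq_square algebra_simps)

text \<open>All isotropic terms are multiples of |xi|^2 |eta|^2, and their total coefficient is
  exactly the balance expression. Only the longitudinal terms survive.\<close>

lemma cell_energy_rank_one:
  assumes "K1 * (1 - b) + 2 * K2 * (1 - c) = 0"
  shows "cell_energy K1 K2 b c (\<lambda>\<rho>. (\<eta> \<bullet> \<rho>) *\<^sub>R \<xi>) =
    K1 * b * ((\<xi> $ 1 * \<eta> $ 1)\<^sup>2 + (\<xi> $ 2 * \<eta> $ 2)\<^sup>2) +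
    K2 * c * ((\<xi> $ 1 * \<eta> $ 1 + \<xi> $ 2 * \<eta> $ 2)\<^sup>2 + (\<xi> $ 1 * \<eta> $ 2 + \<xi> $ 2 * \<eta> $ 1)\<^sup>2)"
    (is "?L = ?R")
proof -
  have "?L = (K1 * (1 - b) + 2 * K2 * (1 - c)) * ((\<xi> $ 1)\<^sup>2 + (\<xi> $ 2)\<^sup>2) * ((\<eta> $ 1)\<^sup>2 + (\<eta> $ 2)\<^sup>2) + ?R"
    unfolding cell_energy_def sum_short_bonds sum_long_bonds norm_real2_square
    by (simp add: inner_real2 power2_eq_square field_simps)
  with assms show ?thesis by simp
qed

lemma rank_one_lower_bound:
  fixes x1 x2 y1 y2 t :: real
  assumes "t \<ge> 0"
  shows "min 1 (2 * t) / 2 * ((x1\<^sup>2 + x2\<^sup>2) * (y1\<^sup>2 + y2\<^sup>2)) \<le>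
    (x1 * y1)\<^sup>2 + (x2 * y2)\<^sup>2 + t * ((x1 * y1 + x2 * y2)\<^sup>2 + (x1 * y2 + x2 * y1)\<^sup>2)"
proof -
  \<comment> \<open>For \<open>s\<close> at most both \<open>t\<close> and 1/2, the form with
    \<open>s\<close> in place of \<open>t\<close> exceeds the claimed bound by an explicit
    nonnegative combination of squares.\<close>
  define s where "s = min 1 (2 * t) / 2"
  have s: "0 \<le> s" "s \<le> t" "2 * s \<le> 1"
    using assms by (auto simp: s_def)
  have "s * ((x1\<^sup>2 + x2\<^sup>2) * (y1\<^sup>2 + y2\<^sup>2)) + (1 - 2 * s) * ((x1 * y1)\<^sup>2 + (x2 * y2)\<^sup>2)
      + 2 * s * (x1 * y1 + x2 * y2)\<^sup>2
    = (x1 * y1)\<^sup>2 + (x2 * y2)\<^sup>2 + s * ((x1 * y1 + x2 * y2)\<^sup>2 + (x1 * y2 + x2 * y1)\<^sup>2)"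
    by (simp add: power2_eq_square algebra_simps)
  moreover have "s * ((x1 * y1 + x2 * y2)\<^sup>2 + (x1 * y2 + x2 * y1)\<^sup>2)
      \<le> t * ((x1 * y1 + x2 * y2)\<^sup>2 + (x1 * y2 + x2 * y1)\<^sup>2)"
    using s by (intro mult_right_mono) auto
  moreover have "0 \<le> (1 - 2 * s) * ((x1 * y1)\<^sup>2 + (x2 * y2)\<^sup>2)" "0 \<le> 2 * s * (x1 * y1 + x2 * y2)\<^sup>2"
    using s by auto
  ultimately show ?thesis unfolding s_def[symmetric] by linarith
qed

text \<open>Intended for b = \<beta> and t = \<alpha> \<kappa>; hypothesis \<open>c\<close> is
  phrased so that the whole form has the common factor \<open>K1 * b\<close>.\<close>

lemma lambda_LH_W_atom:
  assumes "r > 0" "K1 > 0" "b > 0" "t > 0"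
    and b: "a1 / r = b" and c: "K2 * (a2 / (sqrt 2 * r)) = K1 * b * t"
    and balance: "K1 * (1 - a1 / r) + 2 * K2 * (1 - a2 / (sqrt 2 * r)) = 0"
  shows "lambda_LH (W_atom a1 a2 K1 K2) vec_of (r *\<^sub>R mat 1) =
    ereal (K1 / 12 * b * min 1 (2 * t))"
proof -
  define q where "q \<xi> \<eta> = (\<xi> $ 1 * \<eta> $ 1)\<^sup>2 + (\<xi> $ 2 * \<eta> $ 2)\<^sup>2
      + t * ((\<xi> $ 1 * \<eta> $ 1 + \<xi> $ 2 * \<eta> $ 2)\<^sup>2 + (\<xi> $ 1 * \<eta> $ 2 + \<xi> $ 2 * \<eta> $ 1)\<^sup>2)"
    for \<xi> \<eta> :: "real^2"
  have L: "L_form (W_atom a1 a2 K1 K2) vec_of (r *\<^sub>R mat 1) (tensor \<xi> \<eta>) (tensor \<xi> \<eta>)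
      = K1 * b * q \<xi> \<eta>" for \<xi> \<eta>
  proof -
    have "L_form (W_atom a1 a2 K1 K2) vec_of (r *\<^sub>R mat 1) (tensor \<xi> \<eta>) (tensor \<xi> \<eta>)
      = cell_energy K1 K2 (a1 / r) (a2 / (sqrt 2 * r)) (\<lambda>\<rho>. (\<eta> \<bullet> \<rho>) *\<^sub>R \<xi>)"
      unfolding L_form_def lin_family_tensor
      by (rule K_form_W_atom[OF \<open>r > 0\<close>, where g = "\<lambda>\<rho>. (\<eta> \<bullet> \<rho>) *\<^sub>R \<xi>"])
    also have "\<dots> = K1 * b * q \<xi> \<eta>"
      unfolding cell_energy_rank_one[OF balance] c unfolding b q_def by (simp add: algebra_simps)
    finally show ?thesis .
  qed
  have ratio: "L_form (W_atom a1 a2 K1 K2) vec_of (r *\<^sub>R mat 1) (tensor \<xi> \<eta>) (tensor \<xi> \<eta>) /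
      ((norm \<xi>)\<^sup>2 * (\<Sum>s\<in>UNIV. (vec_of s \<bullet> \<eta>)\<^sup>2))
      = K1 * b * q \<xi> \<eta> / (6 * ((norm \<xi>)\<^sup>2 * (norm \<eta>)\<^sup>2))" for \<xi> \<eta>
    unfolding L sum_vec_of_inner_square by simp
  show ?thesis
  proof (rule antisym)
    show "ereal (K1 / 12 * b * min 1 (2 * t)) \<le>
        lambda_LH (W_atom a1 a2 K1 K2) vec_of (r *\<^sub>R mat 1)"
      unfolding lambda_LH_def ratio
    proof (intro INF_greatest, clarsimp simp del: times_divide_eq_left)
      fix \<xi> \<eta> :: "real^2" assume "\<xi> \<noteq> 0" "\<eta> \<noteq> 0"
      then have pos: "0 < 6 * ((norm \<xi>)\<^sup>2 * (norm \<eta>)\<^sup>2)" by simp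
      have "min 1 (2 * t) / 2 * ((norm \<xi>)\<^sup>2 * (norm \<eta>)\<^sup>2) \<le> q \<xi> \<eta>"
        unfolding norm_real2_square q_def using \<open>t > 0\<close> by (intro rank_one_lower_bound) simp
      then have "K1 * b * (min 1 (2 * t) / 2 * ((norm \<xi>)\<^sup>2 * (norm \<eta>)\<^sup>2)) \<le> K1 * b * q \<xi> \<eta>"
        using assms by (intro mult_left_mono) auto
      with pos show "K1 / 12 * b * min 1 (2 * t) \<le> K1 * b * q \<xi> \<eta> / (6 * ((norm \<xi>)\<^sup>2 * (norm \<eta>)\<^sup>2))"
        by (subst pos_le_divide_eq) (simp_all add: algebra_simps)
    qed
    have upper: "lambda_LH (W_atom a1 a2 K1 K2) vec_of (r *\<^sub>R mat 1)
        \<le> ereal (K1 * b * q \<xi> \<eta> / (6 * ((norm \<xi>)\<^sup>2 * (norm \<eta>)\<^sup>2)))" if "\<xi> \<noteq> 0" "\<eta> \<noteq> 0" for \<xi> \<eta>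
      unfolding lambda_LH_def ratio using that
      by (intro INF_lower2[where i = "(\<xi>, \<eta>)"]) auto
    show "lambda_LH (W_atom a1 a2 K1 K2) vec_of (r *\<^sub>R mat 1)
        \<le> ereal (K1 / 12 * b * min 1 (2 * t))"
    \<comment> \<open>The two minimisers: the pair e1, e2 annihilates the longitudinal terms of the
      short bonds, and the pair e1 + e2, e1 - e2 annihilates those of the long bonds.\<close>
    proof (cases "2 * t \<le> 1")
      case True
      have "e1 \<noteq> (0::real^2)" "e2 \<noteq> (0::real^2)" by (simp_all add: vec_eq_iff forall_2)
      from upper[OF this] show ?thesis using True by (simp add: q_def norm_real2_square mult_ac)
    next
      case False
      have "e1 + e2 \<noteq> (0::real^2)" "e1 - e2 \<noteq> (0::real^2)" by (simp_all add: vec_eq_iff forall_2)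
      from upper[OF this] show ?thesis using False by (simp add: q_def norm_real2_square mult_ac)
    qed
  qed
qed

section \<open>Coercivity of the lattice energy\<close>

lemma fin_supp_sum:
  fixes F :: "'i \<Rightarrow> 'a \<Rightarrow> real"
  assumes "\<And>i. i \<in> I \<Longrightarrow> fin_supp (F i)"
  shows "fin_supp (\<lambda>x. \<Sum>i\<in>I. F i x)"
  using assms
  by (induction I rule: infinite_finite_induct) (auto intro: fin_supp_add simp: fin_supp_def[of "\<lambda>_. 0"])

lemma total_sum:
  assumes "\<And>i. i \<in> I \<Longrightarrow> fin_supp (F i)"
  shows "total (\<lambda>x. \<Sum>i\<in>I. F i x) = (\<Sum>i\<in>I. total (F i))"
  using assms
  by (induction I rule: infinite_finite_induct) (auto simp: total_add fin_supp_sum)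

lemma diff_energy_uminus: "diff_energy h (\<lambda>x. - f x) = diff_energy h f"
  unfolding diff_energy_def by (rule infsum_cong) (simp add: power2_eq_square algebra_simps)

lemma total_bond_energy:
  fixes y :: "'a::ab_group_add \<Rightarrow> real^2"
  assumes "fin_supp (\<lambda>x. y x $ 1)" "fin_supp (\<lambda>x. y x $ 2)"
  shows "total (\<lambda>x. p * (norm (y (x + h) - y x))\<^sup>2 + q * (\<rho> \<bullet> (y (x + h) - y x))\<^sup>2) =
      p * (diff_energy h (\<lambda>x. y x $ 1) + diff_energy h (\<lambda>x. y x $ 2))
      + q * diff_energy h (\<lambda>x. \<rho> \<bullet> y x)"
    and "fin_supp (\<lambda>x. p * (norm (y (x + h) - y x))\<^sup>2 + q * (\<rho> \<bullet> (y (x + h) - y x))\<^sup>2)"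
proof -
  note fs = assms fin_supp_shift[OF assms(1)] fin_supp_shift[OF assms(2)] fin_supp_intros
  have \<rho>: "fin_supp (\<lambda>x. (\<rho> \<bullet> y (x + h) - \<rho> \<bullet> y x)\<^sup>2)"
    unfolding inner_real2 by (intro fs)
  show "total (\<lambda>x. p * (norm (y (x + h) - y x))\<^sup>2 + q * (\<rho> \<bullet> (y (x + h) - y x))\<^sup>2) =
      p * (diff_energy h (\<lambda>x. y x $ 1) + diff_energy h (\<lambda>x. y x $ 2))
      + q * diff_energy h (\<lambda>x. \<rho> \<bullet> y x)"
    unfolding norm_real2_square diff_energy_def inner_diff_right
    by (simp add: total_add total_cmult fs \<rho>)
  show "fin_supp (\<lambda>x. p * (norm (y (x + h) - y x))\<^sup>2 + q * (\<rho> \<bullet> (y (x + h) - y x))\<^sup>2)"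
    unfolding norm_real2_square inner_diff_right by (simp add: fs \<rho>)
qed

text \<open>Opposite bonds have equal total energy, hence the factor 2 and one representative per
  direction. Along the diagonals the longitudinal components are y1 + y2 and y1 - y2.\<close>

lemma
  fixes y :: "real^2 \<Rightarrow> real^2"
  assumes "fin_supp (\<lambda>x. y x $ 1)" "fin_supp (\<lambda>x. y x $ 2)"
  defines "E \<equiv> \<lambda>h. diff_energy h (\<lambda>x. y x $ 1) + diff_energy h (\<lambda>x. y x $ 2)"
  shows total_short_bonds:
    "total (\<lambda>x. \<Sum>\<rho>\<in>short_bonds. p * (norm (y (x + \<epsilon> *\<^sub>R \<rho>) - y x))\<^sup>2
        + q * (\<rho> \<bullet> (y (x + \<epsilon> *\<^sub>R \<rho>) - y x))\<^sup>2)
      = 2 * p * (E (\<epsilon> *\<^sub>R e1) + E (\<epsilon> *\<^sub>R e2))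
        + 2 * q * (diff_energy (\<epsilon> *\<^sub>R e1) (\<lambda>x. y x $ 1) + diff_energy (\<epsilon> *\<^sub>R e2) (\<lambda>x. y x $ 2))"
    and total_long_bonds:
    "total (\<lambda>x. \<Sum>\<rho>\<in>long_bonds. p * (norm (y (x + \<epsilon> *\<^sub>R \<rho>) - y x))\<^sup>2
        + q * (\<rho> \<bullet> (y (x + \<epsilon> *\<^sub>R \<rho>) - y x))\<^sup>2)
      = 2 * p * (E (\<epsilon> *\<^sub>R e1 + \<epsilon> *\<^sub>R e2) + E (\<epsilon> *\<^sub>R e1 - \<epsilon> *\<^sub>R e2))
        + 2 * q * (diff_energy (\<epsilon> *\<^sub>R e1 + \<epsilon> *\<^sub>R e2) (\<lambda>x. y x $ 1 + y x $ 2)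
          + diff_energy (\<epsilon> *\<^sub>R e1 - \<epsilon> *\<^sub>R e2) (\<lambda>x. y x $ 1 - y x $ 2))"
    and fin_supp_bonds:
    "fin_supp (\<lambda>x. \<Sum>\<rho>\<in>R. p * (norm (y (x + \<epsilon> *\<^sub>R \<rho>) - y x))\<^sup>2
        + q * (\<rho> \<bullet> (y (x + \<epsilon> *\<^sub>R \<rho>) - y x))\<^sup>2)"
proof -
  note bond = total_bond_energy[OF assms(1,2)]
  define T where "T \<rho> = p * E (\<epsilon> *\<^sub>R \<rho>) + q * diff_energy (\<epsilon> *\<^sub>R \<rho>) (\<lambda>x. \<rho> \<bullet> y x)" for \<rho>
  have total: "total (\<lambda>x. \<Sum>\<rho>\<in>R. p * (norm (y (x + \<epsilon> *\<^sub>R \<rho>) - y x))\<^sup>2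
        + q * (\<rho> \<bullet> (y (x + \<epsilon> *\<^sub>R \<rho>) - y x))\<^sup>2) = sum T R" for R
    by (simp add: total_sum bond T_def E_def)
  have minus: "T (- \<rho>) = T \<rho>" for \<rho>
    by (simp add: T_def E_def diff_energy_minus diff_energy_uminus)
  have e: "- e1 + e2 = - (e1 - e2 :: real^2)" "- e1 - e2 = - (e1 + e2 :: real^2)"
    by simp_all
  show "total (\<lambda>x. \<Sum>\<rho>\<in>short_bonds. p * (norm (y (x + \<epsilon> *\<^sub>R \<rho>) - y x))\<^sup>2
        + q * (\<rho> \<bullet> (y (x + \<epsilon> *\<^sub>R \<rho>) - y x))\<^sup>2)
      = 2 * p * (E (\<epsilon> *\<^sub>R e1) + E (\<epsilon> *\<^sub>R e2))
        + 2 * q * (diff_energy (\<epsilon> *\<^sub>R e1) (\<lambda>x. y x $ 1) + diff_energy (\<epsilon> *\<^sub>R e2) (\<lambda>x. y x $ 2))"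
    unfolding total unfolding sum_short_bonds minus by (simp add: T_def inner_real2 algebra_simps)
  show "total (\<lambda>x. \<Sum>\<rho>\<in>long_bonds. p * (norm (y (x + \<epsilon> *\<^sub>R \<rho>) - y x))\<^sup>2
        + q * (\<rho> \<bullet> (y (x + \<epsilon> *\<^sub>R \<rho>) - y x))\<^sup>2)
      = 2 * p * (E (\<epsilon> *\<^sub>R e1 + \<epsilon> *\<^sub>R e2) + E (\<epsilon> *\<^sub>R e1 - \<epsilon> *\<^sub>R e2))
        + 2 * q * (diff_energy (\<epsilon> *\<^sub>R e1 + \<epsilon> *\<^sub>R e2) (\<lambda>x. y x $ 1 + y x $ 2)
          + diff_energy (\<epsilon> *\<^sub>R e1 - \<epsilon> *\<^sub>R e2) (\<lambda>x. y x $ 1 - y x $ 2))"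
    unfolding total unfolding sum_long_bonds unfolding e minus by (simp add: T_def inner_real2 algebra_simps)
  show "fin_supp (\<lambda>x. \<Sum>\<rho>\<in>R. p * (norm (y (x + \<epsilon> *\<^sub>R \<rho>) - y x))\<^sup>2
        + q * (\<rho> \<bullet> (y (x + \<epsilon> *\<^sub>R \<rho>) - y x))\<^sup>2)"
    by (intro fin_supp_sum bond)
qed

text \<open>The constant comes from comparing two bounds: a sixth of the total squared difference is
  at most 5 (A + B) + 3 Y by Korn, while the energy is at least K1 min(b, 2 - b) (A + B) + (K2 c /
  2) Y. Matching coefficients gives the divisors 5 and 6 inside the minimum.\<close>

lemma energy_coercive:
  fixes y :: "real^2 \<Rightarrow> real^2"
  assumes fs: "fin_supp (\<lambda>x. y x $ 1)" "fin_supp (\<lambda>x. y x $ 2)"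
    and pos: "K1 > 0" "K2 > 0" "0 < b" "b < 2" "0 < c"
    and balance: "K1 * (1 - b) + 2 * K2 * (1 - c) = 0"
  shows "min (K1 * min b (2 - b) / 5) (K2 * c / 6) / 6 *
      total (\<lambda>x. \<Sum>\<rho>\<in>short_bonds \<union> long_bonds. (norm (y (x + \<epsilon> *\<^sub>R \<rho>) - y x))\<^sup>2)
    \<le> total (\<lambda>x. cell_energy K1 K2 b c (\<lambda>\<rho>. y (x + \<epsilon> *\<^sub>R \<rho>) - y x))"
    (is "?m / 6 * ?D \<le> ?Q")
proof -
  define f g where "f = (\<lambda>x. y x $ 1)" and "g = (\<lambda>x. y x $ 2)"
  define h k where "h = \<epsilon> *\<^sub>R e1" and "k = \<epsilon> *\<^sub>R e2"
  \<comment> \<open>\<open>A\<close> and \<open>B\<close> are the longitudinal and \<open>P\<close>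
    and \<open>R\<close> the transverse energies of the short bonds; \<open>X\<close> and
    \<open>Y\<close> are the longitudinal energies along the two diagonals.\<close>
  define A B P R where "A = diff_energy h f" and "B = diff_energy k g"
    and "P = diff_energy k f" and "R = diff_energy h g"
  define X Y where "X = diff_energy (h + k) (\<lambda>x. y x $ 1 + y x $ 2)"
    and "Y = diff_energy (h - k) (\<lambda>x. y x $ 1 - y x $ 2)"
  define M where "M = mixed_energy h k f + mixed_energy h k g"
  have fs': "fin_supp f" "fin_supp g" using fs by (simp_all add: f_def g_def)
  note fold = f_def[symmetric] g_def[symmetric] h_def[symmetric] k_def[symmetric]
    A_def[symmetric] B_def[symmetric] P_def[symmetric] R_def[symmetric]
    X_def[symmetric] Y_def[symmetric]
  note short = total_short_bonds[OF fs, of _ \<epsilon>, unfolded fold]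
  note long = total_long_bonds[OF fs, of _ \<epsilon>, unfolded fold]
  have nonneg: "0 \<le> A" "0 \<le> B" "0 \<le> P" "0 \<le> R" "0 \<le> X" "0 \<le> Y" "0 \<le> M"
    by (simp_all add: A_def B_def P_def R_def X_def Y_def M_def diff_energy_nonneg mixed_energy_nonneg)
  have diag: "diff_energy (h + k) f + diff_energy (h + k) g
      + (diff_energy (h - k) f + diff_energy (h - k) g) = 2 * (A + B + P + R) - M"
    using diff_energy_diagonals[OF fs'(1), of h k] diff_energy_diagonals[OF fs'(2), of h k]
    by (simp add: A_def B_def P_def R_def M_def)
  have M: "M \<le> 4 * (A + B)"
    using mixed_energy_le[OF fs'(1), of k h] mixed_energy_le[OF fs'(2), of h k]
    by (simp add: A_def B_def M_def mixed_energy_commute[of k h])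
  have Korn: "P + R \<le> 4 * (A + B) + 3 * Y"
    using discrete_Korn[OF fs', of k h] by (simp add: A_def B_def P_def R_def Y_def f_def g_def)
  have D: "?D = 6 * (A + B + P + R) - 2 * M"
  proof -
    have "?D = total (\<lambda>x. (\<Sum>\<rho>\<in>short_bonds. 1 * (norm (y (x + \<epsilon> *\<^sub>R \<rho>) - y x))\<^sup>2
          + 0 * (\<rho> \<bullet> (y (x + \<epsilon> *\<^sub>R \<rho>) - y x))\<^sup>2)
        + (\<Sum>\<rho>\<in>long_bonds. 1 * (norm (y (x + \<epsilon> *\<^sub>R \<rho>) - y x))\<^sup>2
          + 0 * (\<rho> \<bullet> (y (x + \<epsilon> *\<^sub>R \<rho>) - y x))\<^sup>2))"
      unfolding sum.union_disjoint[OF finite_bonds bonds_disjoint] by simp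
    also have "\<dots> = 6 * (A + B + P + R) - 2 * M"
      unfolding total_add[OF fin_supp_bonds[OF fs] fin_supp_bonds[OF fs]] short long diag by simp
    finally show ?thesis .
  qed
  have "?Q = K1 / 2 * (2 * (1 - b) * (A + R + (P + B)) + 2 * b * (A + B))
      + K2 / 2 * (2 * (1 - c) * (2 * (A + B + P + R) - M) + 2 * (c / 2) * (X + Y))"
    unfolding cell_energy_def
      total_add[OF fin_supp_cmult[OF fin_supp_bonds[OF fs]] fin_supp_cmult[OF fin_supp_bonds[OF fs]]]
      total_cmult short long diag by simp
  \<comment> \<open>Both isotropic contributions are grouped around A + B + P + R - M/2, whose
    coefficient vanishes by balance; the short bonds leave the defect (1 - b) M / 2.\<close>
  also have "\<dots> = (K1 * (1 - b) + 2 * K2 * (1 - c)) * ((A + B + P + R) - M / 2)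
      + K1 * (b * (A + B) + (1 - b) / 2 * M) + K2 * c / 2 * (X + Y)"
    by (simp add: field_simps)
  finally have Q: "?Q = K1 * (b * (A + B) + (1 - b) / 2 * M) + K2 * c / 2 * (X + Y)"
    using balance by simp
  \<comment> \<open>For b at most 1 the defect is nonnegative. Otherwise M <= 4 (A + B) lowers the
    coefficient b to b - 2 (b - 1) = 2 - b, which is positive exactly below the threshold 2.\<close>
  have "min b (2 - b) * (A + B) \<le> b * (A + B) + (1 - b) / 2 * M"
  proof (cases "b \<le> 1")
    case True
    then have "0 \<le> (1 - b) / 2 * M" using nonneg by simp
    then show ?thesis using True by simp
  next
    case False
    then have "(b - 1) / 2 * M \<le> (b - 1) / 2 * (4 * (A + B))"
      using M by (intro mult_left_mono) auto
    with False show ?thesis by (simp add: field_simps)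
  qed
  then have "K1 * (min b (2 - b) * (A + B)) \<le> K1 * (b * (A + B) + (1 - b) / 2 * M)"
    using pos by (intro mult_left_mono) auto
  moreover have "K2 * c / 2 * Y \<le> K2 * c / 2 * (X + Y)"
    using pos nonneg by (intro mult_left_mono) auto
  ultimately have lower: "K1 * (min b (2 - b) * (A + B)) + K2 * c / 2 * Y \<le> ?Q"
    unfolding Q by simp
  have m: "0 \<le> ?m" using pos by simp
  have "?m / 6 * ?D \<le> ?m / 6 * (6 * (5 * (A + B) + 3 * Y))"
    unfolding D using m Korn nonneg by (intro mult_left_mono) auto
  also have "\<dots> = ?m * (5 * (A + B)) + ?m * (3 * Y)"
    by (simp add: algebra_simps)
  also have "\<dots> \<le> (K1 * min b (2 - b) / 5) * (5 * (A + B)) + (K2 * c / 6) * (3 * Y)"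
    using nonneg by (intro add_mono mult_right_mono) auto
  also have "\<dots> = K1 * (min b (2 - b) * (A + B)) + K2 * c / 2 * Y"
    by (simp add: field_simps)
  finally show ?thesis using lower by linarith
qed

section \<open>Positivity of the atomistic constant\<close>

lemma finite_bounded_lattice:
  fixes \<Omega> :: "(real^'d) set"
  assumes "bounded \<Omega>" "\<epsilon> > 0"
  shows "finite (\<Omega> \<inter> lattice \<epsilon>)"
proof -
  obtain B where B: "\<And>x. x \<in> \<Omega> \<Longrightarrow> norm x \<le> B"
    using assms(1) by (auto simp: bounded_iff)
  define N where "N = \<lceil>B / \<epsilon>\<rceil>"
  let ?Z = "{z::real^'d. \<forall>i. z $ i \<in> real_of_int ` {- N..N}}"
  have "vec_nth ` ?Z \<subseteq> PiE UNIV (\<lambda>_. real_of_int ` {- N..N})" by auto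
  then have "finite (vec_nth ` ?Z)"
    by (rule finite_subset) (simp add: finite_PiE)
  then have "finite ?Z"
    by (rule finite_imageD) (simp add: inj_on_def vec_nth_inject)
  moreover have "\<Omega> \<inter> lattice \<epsilon> \<subseteq> (*\<^sub>R) \<epsilon> ` ?Z"
  proof
    fix x assume x: "x \<in> \<Omega> \<inter> lattice \<epsilon>"
    then obtain z where z: "x = \<epsilon> *\<^sub>R z" "\<And>i. z $ i \<in> \<int>" by (auto simp: lattice_def)
    have "z $ i \<in> real_of_int ` {- N..N}" for i
    proof -
      obtain n where n: "z $ i = of_int n" using z(2) by (meson Ints_cases)
      have "\<epsilon> * \<bar>z $ i\<bar> \<le> B"
        using order.trans[OF component_le_norm_cart[of x i] B[of x]] x assms(2)
        by (simp add: z(1) abs_mult)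
      then have "\<bar>of_int n\<bar> \<le> B / \<epsilon>"
        using assms(2) by (simp add: n field_simps)
      then have "n \<in> {- N..N}" unfolding N_def atLeastAtMost_iff by linarith
      then show ?thesis using n by blast
    qed
    then show "x \<in> (*\<^sub>R) \<epsilon> ` ?Z" using z(1) by auto
  qed
  ultimately show ?thesis by (meson finite_imageI finite_subset)
qed

lemma finite_sint: "bounded \<Omega> \<Longrightarrow> \<epsilon> > 0 \<Longrightarrow> finite (sint \<rho> \<epsilon> \<Omega>)"
  by (rule finite_subset[OF _ finite_bounded_lattice]) (auto simp: sint_def)

text \<open>A segment from \<open>p\<close> to a point outside the set would cross the frontier
  within distance \<open>t\<close> of \<open>p\<close>; the second claim is the 1-Lipschitz property
  of the distance to the frontier.\<close>

lemma infdist_frontier_stable: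
  fixes \<Omega> :: "'a::real_normed_vector set"
  assumes "p \<in> \<Omega>" "infdist p (frontier \<Omega>) > s + t" "dist p x \<le> t" "s \<ge> 0"
  shows "x \<in> \<Omega>" "infdist x (frontier \<Omega>) > s"
proof -
  show "x \<in> \<Omega>"
  proof (rule ccontr)
    assume "x \<notin> \<Omega>"
    then have "closed_segment p x \<inter> frontier \<Omega> \<noteq> {}"
      using assms(1) by (intro connected_Int_frontier) auto
    then obtain z where z: "z \<in> closed_segment p x" "z \<in> frontier \<Omega>" by auto
    have "infdist p (frontier \<Omega>) \<le> dist p z" using z(2) by (rule infdist_le)
    also have "\<dots> \<le> dist p x" using segment_bound(1)[OF z(1)] by (simp add: dist_norm norm_minus_commute)
    finally show False using assms by linarith
  qed
  show "infdist x (frontier \<Omega>) > s"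
    using infdist_triangle[of p "frontier \<Omega>" x] assms by linarith
qed

lemma norm_le_R0: "norm (\<rho> r) \<le> R0 \<rho>"
  unfolding R0_def by (intro max.coboundedI1 Max_ge) auto

lemma R0_pos: "0 < R0 (\<rho> :: 'r::finite \<Rightarrow> real^'d)"
  unfolding R0_def by (simp add: less_max_iff_disj)

lemma norm_bond_le_R0: "\<rho> \<in> short_bonds \<union> long_bonds \<Longrightarrow> norm \<rho> \<le> R0 vec_of"
  using bij_betw_imp_surj_on[OF bij_betw_vec_of] norm_le_R0[of vec_of] by (metis imageE)

lemma bond_Ints: "\<rho> \<in> short_bonds \<union> long_bonds \<Longrightarrow> \<rho> $ i \<in> \<int>"
  using exhaust_2[of i] by auto

lemma lattice_add_scaled:
  assumes "x \<in> lattice \<epsilon>" "\<And>i. z $ i \<in> \<int>"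
  shows "x + \<epsilon> *\<^sub>R z \<in> lattice \<epsilon>"
proof -
  obtain z' where "x = \<epsilon> *\<^sub>R z'" "\<And>i. z' $ i \<in> \<int>"
    using assms(1) by (auto simp: lattice_def)
  then have "x + \<epsilon> *\<^sub>R z = \<epsilon> *\<^sub>R (z' + z)" "(z' + z) $ i \<in> \<int>" for i
    using assms(2) by (simp_all add: algebra_simps)
  then show ?thesis unfolding lattice_def by blast
qed

lemma lattice_bond:
  assumes "x + \<epsilon> *\<^sub>R \<rho> \<in> lattice \<epsilon>" "\<rho> \<in> short_bonds \<union> long_bonds"
  shows "x \<in> lattice \<epsilon>"
  using lattice_add_scaled[OF assms(1), of "- \<rho>"] bond_Ints[OF assms(2)] by simp

lemma admissible_support:
  assumes "y \<in> admissible vec_of \<epsilon> \<Omega>" "\<epsilon> > 0" "y x \<noteq> 0"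
  shows "x \<in> sint vec_of \<epsilon> \<Omega>"
proof -
  have "0 < \<epsilon> * R0 vec_of"
    using assms(2) R0_pos by (intro mult_pos_pos)
  moreover have "x \<in> \<Omega> \<inter> lattice \<epsilon>" "2 * \<epsilon> * R0 vec_of < infdist x (frontier \<Omega>)"
    using assms by (force simp: admissible_def)+
  ultimately show ?thesis by (simp add: sint_def)
qed

text \<open>Admissible functions live deeper than 2 epsilon R0 inside the domain, and a bond moves a
  point by at most epsilon R0. Every stencil that sees a nonzero value is therefore centred in
  \<open>sint\<close>, and the sums lose no boundary terms.\<close>

lemma admissible_support_neighbour:
  assumes "y \<in> admissible vec_of \<epsilon> \<Omega>" "\<epsilon> > 0" "y (x + \<epsilon> *\<^sub>R \<rho>) \<noteq> 0"
    and \<rho>: "\<rho> \<in> short_bonds \<union> long_bonds"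
  shows "x \<in> sint vec_of \<epsilon> \<Omega>"
proof -
  let ?p = "x + \<epsilon> *\<^sub>R \<rho>"
  have p: "?p \<in> \<Omega> \<inter> lattice \<epsilon>" "2 * \<epsilon> * R0 vec_of < infdist ?p (frontier \<Omega>)"
    using assms by (force simp: admissible_def)+
  have "dist ?p x \<le> \<epsilon> * R0 vec_of"
    using norm_bond_le_R0[OF \<rho>] assms(2) by (simp add: dist_norm)
  moreover have "0 \<le> \<epsilon> * R0 vec_of"
    using assms(2) R0_pos[of vec_of] by simp
  ultimately have "x \<in> \<Omega>" "\<epsilon> * R0 vec_of < infdist x (frontier \<Omega>)"
    using infdist_frontier_stable[of ?p \<Omega> "\<epsilon> * R0 vec_of" "\<epsilon> * R0 vec_of" x] p by auto
  then show ?thesis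
    using p(1) lattice_bond[OF _ \<rho>] by (auto simp: sint_def)
qed

lemma fin_supp_admissible:
  assumes "y \<in> admissible vec_of \<epsilon> \<Omega>" "\<epsilon> > 0" "bounded \<Omega>"
  shows "fin_supp y"
  unfolding fin_supp_def
  by (rule finite_subset[OF _ finite_sint[OF assms(3,2)]]) (use admissible_support[OF assms(1,2)] in auto)

text \<open>Summing over all of \<open>real^2\<close> makes the sums translation invariant; off the lattice, all
  terms vanish.\<close>

lemma sum_sint_eq_total:
  assumes "y \<in> admissible vec_of \<epsilon> \<Omega>" "\<epsilon> > 0" "bounded \<Omega>"
    and "\<And>x. y x = 0 \<Longrightarrow> (\<And>\<rho>. \<rho> \<in> short_bonds \<union> long_bonds \<Longrightarrow> y (x + \<epsilon> *\<^sub>R \<rho>) = 0) \<Longrightarrow> F x = 0"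
  shows "sum F (sint vec_of \<epsilon> \<Omega>) = total F"
proof (rule total_eq_sum[symmetric])
  show "F x = 0" if "x \<notin> sint vec_of \<epsilon> \<Omega>" for x
    using that admissible_support[OF assms(1,2)] admissible_support_neighbour[OF assms(1,2)]
    by (intro assms(4)) blast+
qed (rule finite_sint[OF assms(3,2)])

section \<open>The norm of a bond family and the nonvanishing of denominators\<close>

definition bond_norm :: "(real^2 \<Rightarrow> real^2) \<Rightarrow> real" where
  "bond_norm g = (\<Sum>\<rho>\<in>short_bonds \<union> long_bonds. (norm (g \<rho>))\<^sup>2)"

lemma norm_bond_family: "(norm (\<chi> s. g (vec_of s)))\<^sup>2 = bond_norm g"
proof -
  have "(norm (\<chi> s. g (vec_of s)))\<^sup>2 = (\<Sum>s\<in>UNIV. (norm (g (vec_of s)))\<^sup>2)"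
    by (simp add: norm_vec_def L2_set_def sum_nonneg)
  also have "\<dots> = bond_norm g"
    unfolding bond_norm_def using sum.reindex_bij_betw[OF bij_betw_vec_of, of "\<lambda>\<rho>. (norm (g \<rho>))\<^sup>2"] .
  finally show ?thesis .
qed

lemma discrete_grad_vec_of:
  assumes "\<epsilon> > 0"
  shows "discrete_grad vec_of \<epsilon> (\<lambda>x. \<epsilon> *\<^sub>R y x) x = (\<chi> s. (\<lambda>\<rho>. y (x + \<epsilon> *\<^sub>R \<rho>) - y x) (vec_of s))"
  using assms by (simp add: discrete_grad_def scaleR_diff_right)

lemma bond_norm_nonneg: "0 \<le> bond_norm g"
  unfolding bond_norm_def by (simp add: sum_nonneg)

lemma norm_le_bond_norm: "\<rho> \<in> short_bonds \<union> long_bonds \<Longrightarrow> (norm (g \<rho>))\<^sup>2 \<le> bond_norm g"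
  unfolding bond_norm_def
  by (rule member_le_sum[of _ _ "\<lambda>\<rho>. (norm (g \<rho>))\<^sup>2"]) simp_all

text \<open>Take a support point of maximal first coordinate. The nonzero difference found there
  makes the denominator of the quotient positive.\<close>

lemma ex_boundary_point:
  fixes y :: "real^2 \<Rightarrow> real^2"
  assumes "fin_supp y" "y \<noteq> (\<lambda>_. 0)" "\<epsilon> > 0"
  obtains x where "y x \<noteq> 0" "y (x + \<epsilon> *\<^sub>R e1) = 0"
proof -
  let ?S = "{x. y x \<noteq> 0}"
  have S: "finite ?S" "?S \<noteq> {}" using assms by (auto simp: fin_supp_def)
  then have "Max ((\<lambda>x. x $ 1) ` ?S) \<in> (\<lambda>x. x $ 1) ` ?S" by (intro Max_in) auto
  then obtain x where x: "x \<in> ?S" "Max ((\<lambda>x. x $ 1) ` ?S) = x $ 1" by auto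
  have max: "z $ 1 \<le> x $ 1" if "z \<in> ?S" for z
    unfolding x(2)[symmetric] using S that by (intro Max_ge) auto
  have "y (x + \<epsilon> *\<^sub>R e1) = 0"
    using max[of "x + \<epsilon> *\<^sub>R e1"] assms(3) by auto
  with x(1) show ?thesis by (intro that) auto
qed

lemma lambda_atom_pos:
  assumes "bounded \<Omega>" "r > 0"
    and bc: "b = a1 / r" "c = a2 / (sqrt 2 * r)"
    and pos: "K1 > 0" "K2 > 0" "0 < b" "b < 2" "0 < c"
    and balance: "K1 * (1 - b) + 2 * K2 * (1 - c) = 0"
  shows "lambda_atom (W_atom a1 a2 K1 K2) vec_of \<Omega> (r *\<^sub>R mat 1) > 0"
proof -
  \<comment> \<open>This constant depends neither on \<open>\<epsilon>\<close> nor on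
    \<open>y\<close>, so it bounds the double infimum.\<close>
  define m where "m = min (K1 * min b (2 - b) / 5) (K2 * c / 6) / 6"
  have "m > 0" using pos by (simp add: m_def)
  have "m \<le> (\<Sum>x\<in>sint vec_of \<epsilon> \<Omega>. K_form (W_atom a1 a2 K1 K2) vec_of (r *\<^sub>R mat 1)
        (discrete_grad vec_of \<epsilon> y x) (discrete_grad vec_of \<epsilon> y x)) /
      (\<Sum>x\<in>sint vec_of \<epsilon> \<Omega>. (norm (discrete_grad vec_of \<epsilon> y x))\<^sup>2)"
    if "\<epsilon> > 0" "y \<in> admissible vec_of \<epsilon> \<Omega>" "y \<noteq> (\<lambda>_. 0)" for \<epsilon> y
  proof -
    \<comment> \<open>Rescaling by epsilon turns difference quotients into plain differences, to
      which \<open>energy_coercive\<close> applies.\<close>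
    define u where "u x = (1 / \<epsilon>) *\<^sub>R y x" for x
    have y: "y = (\<lambda>x. \<epsilon> *\<^sub>R u x)" using \<open>\<epsilon> > 0\<close> by (simp add: u_def)
    define D where "D x = (\<lambda>\<rho>. u (x + \<epsilon> *\<^sub>R \<rho>) - u x)" for x
    have grad: "discrete_grad vec_of \<epsilon> y x = (\<chi> s. D x (vec_of s))" for x
      unfolding y D_def by (rule discrete_grad_vec_of[OF \<open>\<epsilon> > 0\<close>])
    have D0: "D x \<rho> = 0" if "y x = 0" "\<And>\<rho>. \<rho> \<in> short_bonds \<union> long_bonds \<Longrightarrow> y (x + \<epsilon> *\<^sub>R \<rho>) = 0"
      "\<rho> \<in> short_bonds \<union> long_bonds" for x \<rho>
      unfolding D_def u_def using that(1) that(2)[OF that(3)] by simp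
    have num: "(\<Sum>x\<in>sint vec_of \<epsilon> \<Omega>. cell_energy K1 K2 b c (D x)) =
        total (\<lambda>x. cell_energy K1 K2 b c (D x))"
    proof (rule sum_sint_eq_total[OF that(2,1) assms(1)])
      fix x assume "y x = 0" "\<And>\<rho>. \<rho> \<in> short_bonds \<union> long_bonds \<Longrightarrow> y (x + \<epsilon> *\<^sub>R \<rho>) = 0"
      from D0[OF this] show "cell_energy K1 K2 b c (D x) = 0"
        unfolding cell_energy_def sum_short_bonds sum_long_bonds by simp
    qed
    have den: "(\<Sum>x\<in>sint vec_of \<epsilon> \<Omega>. bond_norm (D x)) = total (\<lambda>x. bond_norm (D x))"
    proof (rule sum_sint_eq_total[OF that(2,1) assms(1)])
      fix x assume "y x = 0" "\<And>\<rho>. \<rho> \<in> short_bonds \<union> long_bonds \<Longrightarrow> y (x + \<epsilon> *\<^sub>R \<rho>) = 0"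
      from D0[OF this] show "bond_norm (D x) = 0"
        unfolding bond_norm_def by (intro sum.neutral) simp
    qed
    have fy: "fin_supp y" by (rule fin_supp_admissible[OF that(2,1) assms(1)])
    have fu: "fin_supp (\<lambda>x. u x $ i)" for i
      by (rule fin_supp_subset[OF fy]) (simp add: u_def)
    obtain x0 where x0: "y x0 \<noteq> 0" "y (x0 + \<epsilon> *\<^sub>R e1) = 0"
      using ex_boundary_point[OF fy \<open>y \<noteq> (\<lambda>_. 0)\<close> \<open>\<epsilon> > 0\<close>] .
    have "0 < (norm (D x0 e1))\<^sup>2"
      using x0 \<open>\<epsilon> > 0\<close> by (simp add: D_def u_def)
    also have "\<dots> \<le> bond_norm (D x0)" by (rule norm_le_bond_norm) simp
    also have "\<dots> \<le> (\<Sum>x\<in>sint vec_of \<epsilon> \<Omega>. bond_norm (D x))"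
      by (rule member_le_sum[of x0 _ "\<lambda>x. bond_norm (D x)"])
        (use admissible_support[OF that(2,1)] x0 finite_sint[OF assms(1) that(1)] in
          \<open>auto simp: bond_norm_nonneg\<close>)
    finally have "0 < (\<Sum>x\<in>sint vec_of \<epsilon> \<Omega>. bond_norm (D x))" .
    moreover have "m * total (\<lambda>x. bond_norm (D x)) \<le> total (\<lambda>x. cell_energy K1 K2 b c (D x))"
      using energy_coercive[OF fu[of 1] fu[of 2] pos balance, of \<epsilon>]
      unfolding m_def bond_norm_def D_def .
    ultimately show ?thesis
      unfolding grad norm_bond_family K_form_W_atom[OF \<open>r > 0\<close>] bc[symmetric]
      unfolding num den by (simp add: pos_le_divide_eq)
  qed
  then have "ereal m \<le> lambda_atom (W_atom a1 a2 K1 K2) vec_of \<Omega> (r *\<^sub>R mat 1)"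
    unfolding lambda_atom_def by (intro INF_greatest) auto
  with \<open>m > 0\<close> show ?thesis by (meson ereal_less(2) less_le_trans)
qed

section \<open>The checkerboard instability\<close>

definition chess :: "int \<Rightarrow> int \<Rightarrow> int \<Rightarrow> real" where
  "chess n i j = (if i \<in> {0..<n} \<and> j \<in> {0..<n} then if even (i + j) then 1 else - 1 else 0)"

text \<open>Bond coordinates are integers, so the floor merely converts them to type
  \<open>int\<close>.\<close>

definition chess_diff :: "int \<Rightarrow> int \<Rightarrow> int \<Rightarrow> real^2 \<Rightarrow> real^2" where
  "chess_diff n i j \<rho> = (chess n (i + \<lfloor>\<rho> $ 1\<rfloor>) (j + \<lfloor>\<rho> $ 2\<rfloor>) - chess n i j) *\<^sub>R e1"

lemma floor_minus_one: "\<lfloor>- 1 :: real\<rfloor> = - 1"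
  using floor_of_int[of "- 1", where 'a = real] by simp

text \<open>The parity of the coordinate sum decides whether a bond flips the checkerboard sign:
  short bonds do, long bonds do not.\<close>

lemma floor_short_bonds:
  "\<rho> \<in> short_bonds \<Longrightarrow> \<bar>\<lfloor>\<rho> $ i\<rfloor>\<bar> \<le> 1 \<and> odd (\<lfloor>\<rho> $ 1\<rfloor> + \<lfloor>\<rho> $ 2\<rfloor>)"
  using exhaust_2[of i] by (auto simp: floor_minus_one)

lemma floor_long_bonds:
  "\<rho> \<in> long_bonds \<Longrightarrow> \<bar>\<lfloor>\<rho> $ i\<rfloor>\<bar> \<le> 1 \<and> even (\<lfloor>\<rho> $ 1\<rfloor> + \<lfloor>\<rho> $ 2\<rfloor>)"
  using exhaust_2[of i] by (auto simp: floor_minus_one)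

text \<open>The index range \<open>{1..n - 2}\<close> keeps all eight neighbours inside the box
  \<open>{0..<n}\<close>.\<close>

lemma chess_shift:
  assumes "i \<in> {1..n - 2}" "j \<in> {1..n - 2}" "\<bar>k\<bar> \<le> 1" "\<bar>l\<bar> \<le> 1"
  shows "chess n (i + k) (j + l) = (if even (k + l) then chess n i j else - chess n i j)"
proof -
  have "i + k \<in> {0..<n}" "j + l \<in> {0..<n}" "i \<in> {0..<n}" "j \<in> {0..<n}"
    using assms by auto
  then show ?thesis unfolding chess_def by simp presburger
qed

lemma chess_diff_short:
  assumes "i \<in> {1..n - 2}" "j \<in> {1..n - 2}" "\<rho> \<in> short_bonds"
  shows "chess_diff n i j \<rho> = (- 2 * chess n i j) *\<^sub>R e1"
  using floor_short_bonds[OF assms(3)] by (simp add: chess_diff_def chess_shift[OF assms(1,2)])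

lemma chess_diff_long:
  assumes "i \<in> {1..n - 2}" "j \<in> {1..n - 2}" "\<rho> \<in> long_bonds"
  shows "chess_diff n i j \<rho> = 0"
  using floor_long_bonds[OF assms(3)] by (simp add: chess_diff_def chess_shift[OF assms(1,2)])

lemma chess_interior_square: "i \<in> {1..n - 2} \<Longrightarrow> j \<in> {1..n - 2} \<Longrightarrow> (chess n i j)\<^sup>2 = 1"
  by (simp add: chess_def)

text \<open>Long differences vanish and the four short ones have squared norm 4, but only the two
  along e1 are longitudinal: (K1/2) (16 (1 - b) + 8 b). This is the source of the threshold b =
  2.\<close>

lemma cell_energy_chess_interior:
  assumes "i \<in> {1..n - 2}" "j \<in> {1..n - 2}"
  shows "cell_energy K1 K2 b c (chess_diff n i j) = 4 * K1 * (2 - b)"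
proof -
  have "cell_energy K1 K2 b c (chess_diff n i j) = 4 * K1 * (2 - b) * (chess n i j)\<^sup>2"
    unfolding cell_energy_def sum_short_bonds sum_long_bonds norm_real2_square inner_real2
    by (simp add: chess_diff_short[OF assms] chess_diff_long[OF assms] power2_eq_square algebra_simps)
  then show ?thesis by (simp add: chess_interior_square[OF assms])
qed

lemma chess_diff_outside:
  assumes "(i, j) \<notin> {- 1..n} \<times> {- 1..n}" "\<rho> \<in> short_bonds \<union> long_bonds"
  shows "chess_diff n i j \<rho> = 0"
proof -
  have "\<bar>\<lfloor>\<rho> $ 1\<rfloor>\<bar> \<le> 1" "\<bar>\<lfloor>\<rho> $ 2\<rfloor>\<bar> \<le> 1"
    using assms(2) floor_short_bonds floor_long_bonds by blast+
  then have "chess n (i + \<lfloor>\<rho> $ 1\<rfloor>) (j + \<lfloor>\<rho> $ 2\<rfloor>) = 0" "chess n i j = 0"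
    using assms(1) by (auto simp: chess_def)
  then show ?thesis by (simp add: chess_diff_def)
qed

lemma cell_energy_chess_outside:
  assumes "(i, j) \<notin> {- 1..n} \<times> {- 1..n}"
  shows "cell_energy K1 K2 b c (chess_diff n i j) = 0"
  unfolding cell_energy_def sum_short_bonds sum_long_bonds
  using chess_diff_outside[OF assms] by simp

lemma cell_energy_chess_bound:
  assumes "K1 > 0" "K2 > 0"
  shows "cell_energy K1 K2 b c (chess_diff n i j) \<le>
    8 * (K1 * (\<bar>1 - b\<bar> + \<bar>b\<bar>) + K2 * (\<bar>1 - c\<bar> + \<bar>c / 2\<bar>))"
proof -
  have bond: "p * (norm (chess_diff n i j \<rho>))\<^sup>2 + q * (\<rho> \<bullet> chess_diff n i j \<rho>)\<^sup>2 \<le> 4 * (\<bar>p\<bar> + \<bar>q\<bar>)"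
    if "\<rho> \<in> short_bonds \<union> long_bonds" for p q \<rho>
  proof -
    define t where "t = chess n (i + \<lfloor>\<rho> $ 1\<rfloor>) (j + \<lfloor>\<rho> $ 2\<rfloor>) - chess n i j"
    have "\<bar>t\<bar> \<le> 2" by (auto simp: t_def chess_def)
    then have t: "t\<^sup>2 \<le> 4" using abs_le_square_iff[of t 2] by simp
    have "(norm (chess_diff n i j \<rho>))\<^sup>2 = t\<^sup>2"
      by (simp add: chess_diff_def t_def norm_real2_square)
    moreover have "(\<rho> \<bullet> chess_diff n i j \<rho>)\<^sup>2 \<le> t\<^sup>2"
      using that unfolding chess_diff_def t_def[symmetric] by (auto simp: inner_real2)
    ultimately have le: "\<bar>p * (norm (chess_diff n i j \<rho>))\<^sup>2\<bar> \<le> \<bar>p\<bar> * 4"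
      "\<bar>q * (\<rho> \<bullet> chess_diff n i j \<rho>)\<^sup>2\<bar> \<le> \<bar>q\<bar> * 4"
      using t unfolding abs_mult by (auto intro!: mult_left_mono)
    show ?thesis using add_mono[OF le[THEN abs_le_D1]] by (simp add: mult.commute)
  qed
  have "cell_energy K1 K2 b c (chess_diff n i j) \<le>
      K1 / 2 * (\<Sum>\<rho>\<in>short_bonds. 4 * (\<bar>1 - b\<bar> + \<bar>b\<bar>)) +
      K2 / 2 * (\<Sum>\<rho>\<in>long_bonds. 4 * (\<bar>1 - c\<bar> + \<bar>c / 2\<bar>))"
    unfolding cell_energy_def using assms
    by (intro add_mono mult_left_mono sum_mono bond) auto
  also have "\<dots> = 8 * (K1 * (\<bar>1 - b\<bar> + \<bar>b\<bar>) + K2 * (\<bar>1 - c\<bar> + \<bar>c / 2\<bar>))"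
    unfolding sum_short_bonds sum_long_bonds by (simp add: algebra_simps)
  finally show ?thesis .
qed

lemma bond_norm_chess_interior:
  assumes "i \<in> {1..n - 2}" "j \<in> {1..n - 2}"
  shows "1 \<le> bond_norm (chess_diff n i j)"
proof -
  have "1 \<le> (norm (chess_diff n i j e1))\<^sup>2"
    by (simp add: chess_diff_short[OF assms] power_mult_distrib chess_interior_square[OF assms])
  also have "\<dots> \<le> bond_norm (chess_diff n i j)" by (rule norm_le_bond_norm) simp
  finally show ?thesis .
qed

text \<open>The outer box has side n + 2 and the inner one n - 2, so the count is (n + 2)^2 - (n -
  2)^2.\<close>

lemma card_boundary_layer:
  assumes "n \<ge> 2"
  shows "card ({- 1..n} \<times> {- 1..n} - {1..n - 2} \<times> {1..n - 2}) = nat (8 * n)"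
proof -
  obtain m where n: "n = int m + 2"
    using assms that[of "nat (n - 2)"] by simp
  have "card ({- 1..n} \<times> {- 1..n} - {1..n - 2} \<times> {1..n - 2}) = (m + 4) * (m + 4) - m * m"
    unfolding n by (subst card_Diff_subset) (auto simp: card_cartesian_product nat_add_distrib add.commute)
  also have "\<dots> = 8 * (m + 2)"
    by (simp add: algebra_simps)
  finally show ?thesis by (simp add: n nat_mult_distrib nat_add_distrib)
qed

text \<open>The test function is a checkerboard on n by n lattice points near an interior point,
  with epsilon chosen small enough to fit it in. Only the boundary layer of 8 n cells can contribute
  positive energy, whereas each of the (n - 2)^2 interior cells adds at least 1 to the
  denominator.\<close>

lemma lambda_atom_le:
  fixes n :: int
  assumes "open \<Omega>" "bounded \<Omega>" "\<Omega> \<noteq> {}" "r > 0" "n \<ge> 3"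
    and bc: "b = a1 / r" "c = a2 / (sqrt 2 * r)"
    and pos: "K1 > 0" "K2 > 0" "b \<ge> 2"
  defines "C \<equiv> 8 * (K1 * (\<bar>1 - b\<bar> + \<bar>b\<bar>) + K2 * (\<bar>1 - c\<bar> + \<bar>c / 2\<bar>))"
  shows "lambda_atom (W_atom a1 a2 K1 K2) vec_of \<Omega> (r *\<^sub>R mat 1)
    \<le> ereal (C * (8 * n) / (n - 2)\<^sup>2)"
proof -
  obtain p where p: "p \<in> \<Omega>" using assms(3) by auto
  define d where "d = infdist p (frontier \<Omega>)"
  have "frontier \<Omega> \<noteq> {}"
    using assms(2,3) frontier_eq_empty not_bounded_UNIV by metis
  then have "d > 0"
    unfolding d_def using p \<open>open \<Omega>\<close>
    by (intro infdist_pos_not_in_closed) (auto simp: frontier_def interior_open)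
  \<comment> \<open>The box must stay within distance \<open>d\<close> of the frontier with the
    margin 2 epsilon R0 to spare. In each coordinate it reaches at most epsilon (n + 1) from
    \<open>p\<close>, which covers the index offset and the fractional part of p / epsilon; the
    extra factor 2 makes the inequality strict.\<close>
  define \<epsilon> where "\<epsilon> = d / (2 * (2 * R0 vec_of + 2 * (n + 1)))"
  have R: "0 < 2 * R0 vec_of + 2 * (n + 1)"
    using R0_pos[of vec_of] assms(5) by (intro add_pos_pos) auto
  have \<epsilon>: "\<epsilon> > 0" "2 * \<epsilon> * R0 vec_of + 2 * \<epsilon> * (n + 1) < d"
  proof -
    have half: "d / (2 * z) * z = d / 2" if "z > 0" for z
      using that by simp
    show "\<epsilon> > 0" using R \<open>d > 0\<close> by (simp add: \<epsilon>_def)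
    have "2 * \<epsilon> * R0 vec_of + 2 * \<epsilon> * (n + 1) = \<epsilon> * (2 * R0 vec_of + 2 * (n + 1))"
      by (simp add: algebra_simps)
    also have "\<dots> = d / 2" unfolding \<epsilon>_def by (rule half[OF R])
    finally show "2 * \<epsilon> * R0 vec_of + 2 * \<epsilon> * (n + 1) < d" using \<open>d > 0\<close> by simp
  qed
  \<comment> \<open>Integer lattice coordinates, counted from the cell that contains
    \<open>p\<close>.\<close>
  define I J where "I x = \<lfloor>x $ 1 / \<epsilon>\<rfloor> - \<lfloor>p $ 1 / \<epsilon>\<rfloor>" and "J x = \<lfloor>x $ 2 / \<epsilon>\<rfloor> - \<lfloor>p $ 2 / \<epsilon>\<rfloor>"
    for x :: "real^2"
  define u where "u x = (if x \<in> lattice \<epsilon> then chess n (I x) (J x) else 0) *\<^sub>R e1" for x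
  define y where "y = (\<lambda>x. \<epsilon> *\<^sub>R u x)"
  have lattice_floor: "x $ i = \<epsilon> * \<lfloor>x $ i / \<epsilon>\<rfloor>" if "x \<in> lattice \<epsilon>" for x :: "real^2" and i
    using that \<epsilon>(1) by (force simp: lattice_def elim!: Ints_cases)
  have inj: "inj_on (\<lambda>x. (I x, J x)) (lattice \<epsilon>)"
  proof (rule inj_onI)
    fix x x' :: "real^2"
    assume "x \<in> lattice \<epsilon>" "x' \<in> lattice \<epsilon>" "(I x, J x) = (I x', J x')"
    then show "x = x'"
      unfolding I_def J_def vec_eq_iff forall_2
      by (metis lattice_floor Pair_inject add_right_cancel diff_add_cancel)
  qed
  have y_admissible: "y \<in> admissible vec_of \<epsilon> \<Omega>"
  proof -
    have "x \<in> \<Omega> \<inter> lattice \<epsilon> \<and> 2 * \<epsilon> * R0 vec_of < infdist x (frontier \<Omega>)" if "y x \<noteq> 0" for x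
    proof -
      have x: "x \<in> lattice \<epsilon>" "I x \<in> {0..<n}" "J x \<in> {0..<n}"
        using that by (auto simp: y_def u_def chess_def split: if_splits)
      have comp: "\<bar>p $ i - x $ i\<bar> \<le> \<epsilon> * (n + 1)" if "\<lfloor>x $ i / \<epsilon>\<rfloor> - \<lfloor>p $ i / \<epsilon>\<rfloor> \<in> {0..<n}" for i
      proof -
        have "\<bar>p $ i / \<epsilon> - \<lfloor>x $ i / \<epsilon>\<rfloor>\<bar> \<le> n + 1"
          using that by (simp; linarith)
        then have "\<epsilon> * \<bar>p $ i / \<epsilon> - \<lfloor>x $ i / \<epsilon>\<rfloor>\<bar> \<le> \<epsilon> * (n + 1)"
          using \<epsilon>(1) by (intro mult_left_mono) auto
        also have "\<epsilon> * \<bar>p $ i / \<epsilon> - \<lfloor>x $ i / \<epsilon>\<rfloor>\<bar> = \<bar>\<epsilon> * (p $ i / \<epsilon> - \<lfloor>x $ i / \<epsilon>\<rfloor>)\<bar>"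
          using \<epsilon>(1) by (simp add: abs_mult)
        also have "\<dots> = \<bar>p $ i - x $ i\<bar>"
          using \<epsilon>(1) lattice_floor[OF x(1), of i] by (simp add: right_diff_distrib)
        finally show ?thesis .
      qed
      have "dist p x \<le> \<bar>(p - x) $ 1\<bar> + \<bar>(p - x) $ 2\<bar>"
        using norm_le_l1_cart[of "p - x"] by (simp add: dist_norm sum_2)
      also have "\<dots> \<le> 2 * \<epsilon> * (n + 1)"
        using comp[of 1] comp[of 2] x by (simp add: I_def J_def)
      finally have "dist p x \<le> 2 * \<epsilon> * (n + 1)" .
      moreover have "0 \<le> 2 * \<epsilon> * R0 vec_of"
        using \<epsilon>(1) R0_pos[of vec_of] by simp
      ultimately show ?thesis
        using infdist_frontier_stable[OF p \<epsilon>(2)[unfolded d_def]] x(1) by auto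
    qed
    then show ?thesis unfolding admissible_def by force
  qed
  have grad: "(\<lambda>\<rho>. u (x + \<epsilon> *\<^sub>R \<rho>) - u x) \<rho> = chess_diff n (I x) (J x) \<rho>"
    if "x \<in> lattice \<epsilon>" "\<rho> \<in> short_bonds \<union> long_bonds" for x \<rho>
  proof -
    have "x + \<epsilon> *\<^sub>R \<rho> \<in> lattice \<epsilon>"
      by (rule lattice_add_scaled[OF that(1) bond_Ints[OF that(2)]])
    moreover have "\<lfloor>(x + \<epsilon> *\<^sub>R \<rho>) $ i / \<epsilon>\<rfloor> = \<lfloor>x $ i / \<epsilon>\<rfloor> + \<lfloor>\<rho> $ i\<rfloor>" for i
    proof -
      have "(x + \<epsilon> *\<^sub>R \<rho>) $ i / \<epsilon> = x $ i / \<epsilon> + of_int \<lfloor>\<rho> $ i\<rfloor>"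
        using \<epsilon>(1) bond_Ints[OF that(2), of i] by (simp add: add_divide_distrib Ints_cases)
      then show ?thesis by simp
    qed
    ultimately show ?thesis
      using that(1) by (simp add: u_def chess_diff_def I_def J_def scaleR_diff_left algebra_simps)
  qed
  have grad_family: "discrete_grad vec_of \<epsilon> y x = (\<chi> s. chess_diff n (I x) (J x) (vec_of s))"
    if "x \<in> lattice \<epsilon>" for x
  proof -
    have "(\<lambda>\<rho>. u (x + \<epsilon> *\<^sub>R \<rho>) - u x) (vec_of s) = chess_diff n (I x) (J x) (vec_of s)" for s
      using vec_of_cases[of s] by (intro grad[OF that]) blast
    then show ?thesis unfolding y_def discrete_grad_vec_of[OF \<epsilon>(1)] by (simp only:)
  qed
  let ?S = "sint vec_of \<epsilon> \<Omega>"
  let ?in = "{1..n - 2} \<times> {1..n - 2}" and ?out = "{- 1..n} \<times> {- 1..n}"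
  have S_lattice: "?S \<subseteq> lattice \<epsilon>" by (auto simp: sint_def)
  have "C \<ge> 0" using pos by (simp add: C_def)
  have num: "(\<Sum>x\<in>?S. K_form (W_atom a1 a2 K1 K2) vec_of (r *\<^sub>R mat 1)
        (discrete_grad vec_of \<epsilon> y x) (discrete_grad vec_of \<epsilon> y x)) \<le> C * (8 * n)"
  proof -
    have "(\<Sum>x\<in>?S. K_form (W_atom a1 a2 K1 K2) vec_of (r *\<^sub>R mat 1)
        (discrete_grad vec_of \<epsilon> y x) (discrete_grad vec_of \<epsilon> y x))
      = (\<Sum>x\<in>?S. cell_energy K1 K2 b c (chess_diff n (I x) (J x)))"
      using S_lattice by (intro sum.cong refl) (auto simp: grad_family K_form_W_atom[OF \<open>r > 0\<close>] bc)
    also have "\<dots> = (\<Sum>(i, j)\<in>(\<lambda>x. (I x, J x)) ` ?S. cell_energy K1 K2 b c (chess_diff n i j))"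
      by (subst sum.reindex) (auto intro: inj_on_subset[OF inj S_lattice])
    \<comment> \<open>Interior cells have nonpositive energy because b >= 2, and cells outside the
      enlarged box have none.\<close>
    also have "\<dots> \<le> (\<Sum>ij\<in>(\<lambda>x. (I x, J x)) ` ?S. if ij \<in> ?out - ?in then C else 0)"
    proof (rule sum_mono)
      fix ij :: "int \<times> int"
      obtain i j where ij: "ij = (i, j)" by force
      have "K1 * (2 - b) \<le> 0" using pos by (simp add: mult_nonneg_nonpos)
      then have "cell_energy K1 K2 b c (chess_diff n i j) \<le> 0" if "(i, j) \<notin> ?out - ?in"
        using that cell_energy_chess_outside[of i j n K1 K2 b c]
          cell_energy_chess_interior[of i n j K1 K2 b c] by (cases "(i, j) \<in> ?out") auto
      then show "(case ij of (i, j) \<Rightarrow> cell_energy K1 K2 b c (chess_diff n i j))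
          \<le> (if ij \<in> ?out - ?in then C else 0)"
        using cell_energy_chess_bound[OF pos(1,2), of b c n i j] by (simp add: ij C_def)
    qed
    also have "\<dots> = (\<Sum>ij\<in>(\<lambda>x. (I x, J x)) ` ?S \<inter> (?out - ?in). C)"
      using finite_sint[OF assms(2) \<epsilon>(1)] by (subst sum.inter_restrict) auto
    also have "\<dots> \<le> C * card (?out - ?in)"
      using \<open>C \<ge> 0\<close> by (auto simp: mult.commute intro!: mult_left_mono card_mono)
    also have "\<dots> = C * (8 * n)"
      using assms(5) by (subst card_boundary_layer) auto
    finally show ?thesis .
  qed
  have den: "(n - 2)\<^sup>2 \<le> (\<Sum>x\<in>?S. (norm (discrete_grad vec_of \<epsilon> y x))\<^sup>2)"
  proof -
    \<comment> \<open>A right inverse of the index map (I, J); it shows that every interior index is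
      attained on \<open>sint\<close>.\<close>
    define P where "P = (\<lambda>(i, j). \<epsilon> *\<^sub>R vector [of_int (\<lfloor>p $ 1 / \<epsilon>\<rfloor> + i), of_int (\<lfloor>p $ 2 / \<epsilon>\<rfloor> + j)] :: real^2)"
    have P: "P (i, j) \<in> lattice \<epsilon>" "I (P (i, j)) = i" "J (P (i, j)) = j" for i j
      using \<epsilon>(1) by (auto simp: P_def lattice_def I_def J_def forall_2)
    have "?in \<subseteq> (\<lambda>x. (I x, J x)) ` ?S"
    proof clarify
      fix i j assume ij: "i \<in> {1..n - 2}" "j \<in> {1..n - 2}"
      then have "y (P (i, j)) \<noteq> 0"
        using \<epsilon>(1) P[of i j] by (simp add: y_def u_def chess_def)
      then have "P (i, j) \<in> ?S" by (rule admissible_support[OF y_admissible \<epsilon>(1)])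
      then show "(i, j) \<in> (\<lambda>x. (I x, J x)) ` ?S" using P[of i j] by force
    qed
    have "(n - 2)\<^sup>2 = (\<Sum>ij\<in>?in. 1::real)"
      using assms(5) by (simp add: card_cartesian_product power2_eq_square)
    also have "\<dots> \<le> (\<Sum>(i, j)\<in>?in. bond_norm (chess_diff n i j))"
      by (rule sum_mono) (use bond_norm_chess_interior in auto)
    also have "\<dots> \<le> (\<Sum>(i, j)\<in>(\<lambda>x. (I x, J x)) ` ?S. bond_norm (chess_diff n i j))"
      using \<open>?in \<subseteq> _\<close> finite_sint[OF assms(2) \<epsilon>(1)]
      by (intro sum_mono2) (auto simp: bond_norm_nonneg)
    also have "\<dots> = (\<Sum>x\<in>?S. bond_norm (chess_diff n (I x) (J x)))"
      by (subst sum.reindex) (auto intro: inj_on_subset[OF inj S_lattice])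
    also have "\<dots> = (\<Sum>x\<in>?S. (norm (discrete_grad vec_of \<epsilon> y x))\<^sup>2)"
      using S_lattice by (intro sum.cong refl) (auto simp: grad_family norm_bond_family)
    finally show ?thesis .
  qed
  have "0 < (n - 2)\<^sup>2" using assms(5) by simp
  have "y \<noteq> (\<lambda>_. 0)"
  proof
    assume "y = (\<lambda>_. 0)"
    then have "(\<Sum>x\<in>?S. (norm (discrete_grad vec_of \<epsilon> y x))\<^sup>2) = 0"
      by (simp add: discrete_grad_def norm_vec_def L2_set_def)
    with den \<open>0 < (n - 2)\<^sup>2\<close> show False by linarith
  qed
  with y_admissible \<epsilon>(1)
  have "lambda_atom (W_atom a1 a2 K1 K2) vec_of \<Omega> (r *\<^sub>R mat 1)
    \<le> ereal ((\<Sum>x\<in>?S. K_form (W_atom a1 a2 K1 K2) vec_of (r *\<^sub>R mat 1)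
        (discrete_grad vec_of \<epsilon> y x) (discrete_grad vec_of \<epsilon> y x)) /
      (\<Sum>x\<in>?S. (norm (discrete_grad vec_of \<epsilon> y x))\<^sup>2))"
    unfolding lambda_atom_def by (intro INF_lower2[of \<epsilon>] INF_lower) auto
  also have "\<dots> \<le> ereal (C * (8 * n) / (n - 2)\<^sup>2)"
    unfolding ereal_less_eq using num den \<open>0 < (n - 2)\<^sup>2\<close> \<open>C \<ge> 0\<close> assms(5)
    by (intro frac_le) auto
  finally show ?thesis .
qed

lemma lambda_atom_nonpos:
  assumes "open \<Omega>" "bounded \<Omega>" "\<Omega> \<noteq> {}" "r > 0"
    and bc: "b = a1 / r"
    and pos: "K1 > 0" "K2 > 0" "b \<ge> 2"
  shows "lambda_atom (W_atom a1 a2 K1 K2) vec_of \<Omega> (r *\<^sub>R mat 1) \<le> 0"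
proof -
  define c where "c = a2 / (sqrt 2 * r)"
  define C where "C = 8 * (K1 * (\<bar>1 - b\<bar> + \<bar>b\<bar>) + K2 * (\<bar>1 - c\<bar> + \<bar>c / 2\<bar>))"
  have "C \<ge> 0" using pos by (simp add: C_def)
  have "lambda_atom (W_atom a1 a2 K1 K2) vec_of \<Omega> (r *\<^sub>R mat 1) \<le> ereal (24 * C / real m)"
    if "m \<ge> 1" for m
  proof -
    have "lambda_atom (W_atom a1 a2 K1 K2) vec_of \<Omega> (r *\<^sub>R mat 1)
        \<le> ereal (C * (8 * (int m + 2)) / (int m + 2 - 2)\<^sup>2)"
      unfolding C_def using that
      using lambda_atom_le[OF assms(1-4) _ bc c_def pos, of "int m + 2"] by simp
    \<comment> \<open>With n = m + 2 the bound is 8 C (m + 2) / m^2, and m + 2 <= 3 m for m >=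
      1.\<close>
    also have "\<dots> \<le> ereal (24 * C / real m)"
    proof -
      have "C * (8 * (real m + 2)) \<le> C * (24 * real m)"
        using \<open>C \<ge> 0\<close> that by (intro mult_left_mono) auto
      then have "C * (8 * (real m + 2)) / (real m)\<^sup>2 \<le> C * (24 * real m) / (real m)\<^sup>2"
        by (intro divide_right_mono) auto
      also have "\<dots> = 24 * C / real m"
        using that by (simp add: power2_eq_square)
      finally show ?thesis by simp
    qed
    finally show ?thesis .
  qed
  moreover have "(\<lambda>m. ereal (24 * C / real m)) \<longlonglongrightarrow> ereal 0"
    by (intro tendsto_intros lim_const_over_n)
  ultimately show ?thesis
    by (intro LIMSEQ_le_const[where X = "\<lambda>m. ereal (24 * C / real m)"]) (auto simp: zero_ereal_def)
qed

section \<open>Parameter identities and assembly of the claims\<close>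

theorem proposition3p15:
  fixes a1 a2 K1 K2 r \<alpha> \<kappa> \<beta> :: real and \<Omega> :: "(real^2) set"
  assumes "a1 > 0" "a2 > 0" "K1 > 0" "K2 > 0"
    and "r = (K1 * a1 + sqrt 2 * K2 * a2) / (K1 + 2 * K2)"
    and "\<alpha> = a2 / (sqrt 2 * a1)"
    and "\<kappa> = K2 / K1"
    and "\<beta> = (1 + 2 * \<kappa>) / (1 + 2 * \<alpha> * \<kappa>)"
    and "open \<Omega>" "bounded \<Omega>" "\<Omega> \<noteq> {}"
  shows "lambda_LH (W_atom a1 a2 K1 K2) vec_of (r *\<^sub>R mat 1) =
           ereal (K1 / 12 * \<beta> * min 1 (2 * \<alpha> * \<kappa>)) \<and>
         K1 / 12 * \<beta> * min 1 (2 * \<alpha> * \<kappa>) > 0 \<and>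
         (lambda_atom (W_atom a1 a2 K1 K2) vec_of \<Omega> (r *\<^sub>R mat 1) > 0 \<longleftrightarrow> \<beta> < 2) \<and>
         (\<beta> < 2 \<longleftrightarrow> \<alpha> \<ge> 1 / 2 \<or> (\<alpha> < 1 / 2 \<and> \<kappa> < 1 / (2 * (1 - 2 * \<alpha>))))"
proof (intro conjI)
  have pos: "\<alpha> > 0" "\<kappa> > 0" using assms by simp_all
  then have den: "1 + 2 * \<alpha> * \<kappa> > 0" by (simp add: add_pos_pos)
  then have "\<beta> > 0" using pos assms(8) by simp
  \<comment> \<open>Eliminating \<open>a2\<close> and \<open>K2\<close> in favour of \<alpha> and
    \<kappa> gives r = a1 / \<beta>, which identifies the coefficients \<open>b\<close> and
    \<open>c\<close> as \<beta> and \<alpha> \<beta>.\<close>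
  have a2: "a2 = sqrt 2 * \<alpha> * a1" and K2: "K2 = \<kappa> * K1"
    using assms by simp_all
  have "sqrt 2 * K2 * a2 = K1 * a1 * (2 * \<alpha> * \<kappa>)"
    unfolding a2 K2 by simp
  then have "r = K1 * (a1 * (1 + 2 * \<alpha> * \<kappa>)) / (K1 * (1 + 2 * \<kappa>))"
    unfolding assms(5) K2 by (simp add: algebra_simps)
  then have r: "r = a1 * (1 + 2 * \<alpha> * \<kappa>) / (1 + 2 * \<kappa>)"
    using assms(3) by simp
  then have "r > 0" using assms(1) pos den by simp
  have b: "a1 / r = \<beta>"
    unfolding r assms(8) using assms(1) by simp
  have c: "a2 / (sqrt 2 * r) = \<alpha> * \<beta>"
    unfolding a2 b[symmetric] by simp
  have \<beta>: "\<beta> * (1 + 2 * \<alpha> * \<kappa>) = 1 + 2 * \<kappa>"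
    using den assms(8) by simp
  have "K1 * (1 - \<beta>) + 2 * K2 * (1 - \<alpha> * \<beta>) = K1 * (1 + 2 * \<kappa> - \<beta> * (1 + 2 * \<alpha> * \<kappa>))"
    unfolding K2 by (simp add: algebra_simps)
  then have balance: "K1 * (1 - \<beta>) + 2 * K2 * (1 - \<alpha> * \<beta>) = 0"
    unfolding \<beta> by simp
  have K2c: "K2 * (a2 / (sqrt 2 * r)) = K1 * \<beta> * (\<alpha> * \<kappa>)"
    unfolding c K2 by simp
  show "lambda_LH (W_atom a1 a2 K1 K2) vec_of (r *\<^sub>R mat 1) =
      ereal (K1 / 12 * \<beta> * min 1 (2 * \<alpha> * \<kappa>))"
    using lambda_LH_W_atom[OF \<open>r > 0\<close> assms(3) \<open>\<beta> > 0\<close> _ b K2c, unfolded b c, OF _ balance] pos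
    by (simp add: mult.assoc)
  show "K1 / 12 * \<beta> * min 1 (2 * \<alpha> * \<kappa>) > 0"
    using assms(3) \<open>\<beta> > 0\<close> pos by simp
  show "lambda_atom (W_atom a1 a2 K1 K2) vec_of \<Omega> (r *\<^sub>R mat 1) > 0 \<longleftrightarrow> \<beta> < 2"
  proof
    assume "\<beta> < 2"
    then show "lambda_atom (W_atom a1 a2 K1 K2) vec_of \<Omega> (r *\<^sub>R mat 1) > 0"
      using \<open>\<beta> > 0\<close> pos
      by (intro lambda_atom_pos[OF assms(10) \<open>r > 0\<close> b[symmetric] c[symmetric] assms(3,4) _ _ _ balance]) auto
  next
    assume "lambda_atom (W_atom a1 a2 K1 K2) vec_of \<Omega> (r *\<^sub>R mat 1) > 0"
    then show "\<beta> < 2"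
      using lambda_atom_nonpos[OF assms(9-11) \<open>r > 0\<close> b[symmetric] assms(3,4)] by (metis not_le)
  qed
  \<comment> \<open>Clearing the positive denominator makes the condition linear in \<kappa>; the
    sign of 1 - 2 \<alpha> then decides whether it restricts \<kappa> at all.\<close>
  have "\<beta> < 2 \<longleftrightarrow> 2 * \<kappa> * (1 - 2 * \<alpha>) < 1"
    unfolding assms(8) using den by (simp add: pos_divide_less_eq algebra_simps)
  also have "\<dots> \<longleftrightarrow> \<alpha> \<ge> 1 / 2 \<or> (\<alpha> < 1 / 2 \<and> \<kappa> < 1 / (2 * (1 - 2 * \<alpha>)))"
  proof (cases "\<alpha> < 1 / 2")
    case True
    then show ?thesis by (simp add: pos_less_divide_eq algebra_simps)
  next
    case False
    then have "2 * \<kappa> * (1 - 2 * \<alpha>) \<le> 0" using pos by (simp add: mult_nonneg_nonpos)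
    with False show ?thesis by simp
  qed
  finally show "\<beta> < 2 \<longleftrightarrow> \<alpha> \<ge> 1 / 2 \<or> (\<alpha> < 1 / 2 \<and> \<kappa> < 1 / (2 * (1 - 2 * \<alpha>)))" .
qed

end
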